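(* Let $X$ be a complete metric space. For $s>0$ let $S\subset X$ be $\mathcal H^s$-measurable with $\sigma$-finite $\mathcal H^s$ measure. Suppose that either $s\in\mathbb N$ and $S$ is purely $1$-unrectifiable, or $0<s<1$. Then for any $1\le p\le\infty$, $m\in\mathbb N$ and any $L\ge0$, the set $$\{f\in\operatorname{Lip}(X,\ell_p^m,L):\mathcal H^s(f(S))=0\}$$ is residual in $\operatorname{Lip}(X,\ell_p^m,L)$.
   Context: $\mathcal H^s$ is the $s$-dimensional Hausdorff measure, $\mathcal H^s(S)=\lim_{\delta\to0}\inf\{\sum_{i\in\mathbb N}\operatorname{diam}(S_i)^s: S\subset\bigcup_i S_i,\ \operatorname{diam}(S_i)\le\delta\}$. An $\mathcal H^1$-measurable $E\subset X$ is $1$-rectifiable if there are countably many Lipschitz maps $f_i\colon A_i\subset\mathbb R\to X$ with $\mathcal H^1(E\setminus\bigcup_i f_i(A_i))=0$. An $\mathcal H^1$-measurable $S\subset X$ is purely $1$-unrectifiable if $\mathcal H^1(S\cap E)=0$ for every $1$-rectifiable $E\subset X$. $\operatorname{Lip}(X,Y,L)$ is the set of all bounded $L$-Lipschitz functions $f\colon X\to Y$ with the supremum metric. $\ell_p^m$ is $\mathbb R^m$ with the $p$-norm. A subset of a metric space is residual if it contains a countable intersection of dense open sets. *)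

theory Defs
  imports "HOL-Analysis.Analysis"
begin

section \<open>Hausdorff measure\<close>

text \<open>The distance function is an explicit argument, because the measure is also needed on
  \<open>real ^ 'm\<close> with respect to a \<open>p\<close>-norm, which is not the distance of the type class.\<close>

definition ediam :: "('a \<Rightarrow> 'a \<Rightarrow> real) \<Rightarrow> 'a set \<Rightarrow> ennreal"
  where "ediam d A = (SUP x\<in>A. SUP y\<in>A. ennreal (d x y))"

text \<open>For finite \<open>\<delta>\<close> all sets of an admissible cover have finite diameter, so
  \<^const>\<open>enn2real\<close> loses no information. Only \<open>s > 0\<close> is used;
  then the empty set contributes \<open>0 powr s = 0\<close>.\<close>

definition hausdorff_pre ::
    "('a \<Rightarrow> 'a \<Rightarrow> real) \<Rightarrow> real \<Rightarrow> real \<Rightarrow> 'a set \<Rightarrow> ennreal"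
  where "hausdorff_pre d s \<delta> S =
    (INF C \<in> {C :: nat \<Rightarrow> 'a set. S \<subseteq> (\<Union>i. C i) \<and> (\<forall>i. ediam d (C i) \<le> ennreal \<delta>)}.
       \<Sum>i. ennreal (enn2real (ediam d (C i)) powr s))"

definition hausdorff :: "('a \<Rightarrow> 'a \<Rightarrow> real) \<Rightarrow> real \<Rightarrow> 'a set \<Rightarrow> ennreal"
  where "hausdorff d s S = Lim (at_right 0) (\<lambda>\<delta>. hausdorff_pre d s \<delta> S)"

lemma hausdorff_pre_antimono:
  assumes "\<delta> \<le> \<delta>'"
  shows "hausdorff_pre d s \<delta>' S \<le> hausdorff_pre d s \<delta> S"
proof -
  have "ennreal \<delta> \<le> ennreal \<delta>'"
    using assms by (rule ennreal_leI)
  then show ?thesis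
    unfolding hausdorff_pre_def
    by (intro INF_superset_mono) (auto intro: order_trans)
qed

lemma hausdorff_pre_tendsto:
  "((\<lambda>\<delta>. hausdorff_pre d s \<delta> S) \<longlongrightarrow> (SUP \<delta>\<in>{0<..}. hausdorff_pre d s \<delta> S)) (at_right 0)"
proof (rule increasing_tendsto)
  show "\<forall>\<^sub>F \<delta> in at_right 0. hausdorff_pre d s \<delta> S \<le> (SUP \<delta>\<in>{0<..}. hausdorff_pre d s \<delta> S)"
    using eventually_at_right_less[of 0] by eventually_elim (auto intro: SUP_upper)
next
  fix x assume "x < (SUP \<delta>\<in>{0<..}. hausdorff_pre d s \<delta> S)"
  then obtain e where e: "e > 0" "x < hausdorff_pre d s e S"
    by (auto simp: less_SUP_iff)
  have "\<forall>\<^sub>F \<delta> in at_right 0. \<delta> < e"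
    using e(1) by (auto simp: eventually_at_right_field)
  then show "\<forall>\<^sub>F \<delta> in at_right 0. x < hausdorff_pre d s \<delta> S"
    by eventually_elim (rule less_le_trans[OF e(2) hausdorff_pre_antimono], simp)
qed

lemma hausdorff_eq_SUP: "hausdorff d s S = (SUP \<delta>\<in>{0<..}. hausdorff_pre d s \<delta> S)"
  unfolding hausdorff_def by (rule tendsto_Lim[OF _ hausdorff_pre_tendsto]) simp

text \<open>Measurability with respect to the outer measure \<^const>\<open>hausdorff\<close>, in the sense of
  Caratheodory.\<close>

definition hausdorff_measurable :: "real \<Rightarrow> 'a::metric_space set \<Rightarrow> bool"
  where "hausdorff_measurable s S \<longleftrightarrow> S \<in> lambda_system UNIV UNIV (hausdorff dist s)"

definition sigma_finite_hausdorff :: "real \<Rightarrow> 'a::metric_space set \<Rightarrow> bool"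
  where "sigma_finite_hausdorff s S \<longleftrightarrow>
    (\<exists>A :: nat \<Rightarrow> 'a set.
       (\<forall>i. hausdorff_measurable s (A i) \<and> hausdorff dist s (A i) < \<infinity>) \<and> S = (\<Union>i. A i))"


section \<open>Rectifiability\<close>

definition one_rectifiable :: "'a::metric_space set \<Rightarrow> bool"
  where "one_rectifiable E \<longleftrightarrow>
    hausdorff_measurable 1 E \<and>
    (\<exists>(A :: nat \<Rightarrow> real set) (f :: nat \<Rightarrow> real \<Rightarrow> 'a).
       (\<forall>i. \<exists>C. C-lipschitz_on (A i) (f i)) \<and>
       hausdorff dist 1 (E - (\<Union>i. f i ` A i)) = 0)"

definition purely_one_unrectifiable :: "'a::metric_space set \<Rightarrow> bool"
  where "purely_one_unrectifiable S \<longleftrightarrow>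
    hausdorff_measurable 1 S \<and>
    (\<forall>E. one_rectifiable E \<longrightarrow> hausdorff dist 1 (S \<inter> E) = 0)"


section \<open>The spaces \<open>\<ell>\<^sub>p\<^sup>m\<close>\<close>

definition lp_norm :: "ereal \<Rightarrow> real ^ 'm \<Rightarrow> real"
  where "lp_norm p x =
    (if p = \<infinity> then Max (range (\<lambda>i. \<bar>x $ i\<bar>))
     else (\<Sum>i\<in>UNIV. \<bar>x $ i\<bar> powr real_of_ereal p) powr (1 / real_of_ereal p))"

definition lp_metric :: "ereal \<Rightarrow> (real ^ 'm) metric"
  where "lp_metric p = metric (UNIV, \<lambda>x y. lp_norm p (x - y))"

text \<open>Since \<^const>\<open>metric\<close> is an abstraction function, \<^const>\<open>lp_metric\<close> is only
  meaningful once Minkowski's inequality is available.\<close>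

lemma powr_convex_nonneg:
  fixes p u v t :: real
  assumes "1 \<le> p" "0 \<le> u" "0 \<le> v" "0 < t" "t < 1"
  shows "(t * u + (1 - t) * v) powr p \<le> t * u powr p + (1 - t) * v powr p"
proof -
  have le: "r powr p \<le> r" if "0 < r" "r < 1" for r :: real
    using powr_mono'[of 1 p r] assms(1) that by simp
  consider "u = 0" | "v = 0" | "0 < u" "0 < v"
    using assms by linarith
  then show ?thesis
  proof cases
    case 1
    then show ?thesis
      using le[of "1 - t"] assms by (simp add: powr_mult mult_right_mono)
  next
    case 2
    then show ?thesis
      using le[of t] assms by (simp add: powr_mult mult_right_mono)
  next
    case 3
    have "((1 - t) *\<^sub>R v + t *\<^sub>R u) powr p \<le> (1 - t) * v powr p + t * u powr p"
      by (rule convex_onD[OF powr_convex[OF assms(1)]]) (use assms 3 in auto)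
    then show ?thesis by (simp add: add.commute)
  qed
qed

lemma abs_le_Max_component: "\<bar>x $ i\<bar> \<le> Max (range (\<lambda>i. \<bar>x $ i\<bar>))" for x :: "real ^ 'm"
  by (rule Max_ge) auto

lemma lp_norm_nonneg: "0 \<le> lp_norm p x"
proof (cases "p = \<infinity>")
  case True
  have "0 \<le> \<bar>x $ undefined\<bar>" by simp
  also have "\<dots> \<le> Max (range (\<lambda>i. \<bar>x $ i\<bar>))" by (rule abs_le_Max_component)
  finally show ?thesis using True by (simp add: lp_norm_def)
qed (simp add: lp_norm_def)

lemma lp_norm_minus_commute: "lp_norm p (x - y) = lp_norm p (y - x)"
  by (simp add: lp_norm_def abs_minus_commute)

lemma lp_norm_powr:
  assumes "1 \<le> p" "p \<noteq> \<infinity>"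
  shows "lp_norm p x powr real_of_ereal p = (\<Sum>i\<in>UNIV. \<bar>x $ i\<bar> powr real_of_ereal p)"
proof -
  have "1 \<le> real_of_ereal p"
    using assms by (cases p) auto
  then show ?thesis
    using assms(2) by (simp add: lp_norm_def powr_powr sum_nonneg)
qed

lemma lp_norm_eq_0_iff:
  assumes "1 \<le> p"
  shows "lp_norm p x = 0 \<longleftrightarrow> x = 0"
proof (cases "p = \<infinity>")
  case True
  show ?thesis
  proof
    assume 0: "lp_norm p x = 0"
    have "\<bar>x $ i\<bar> \<le> 0" for i
      using abs_le_Max_component[of x i] 0 True unfolding lp_norm_def by metis
    then show "x = 0" by (simp add: vec_eq_iff)
  next
    assume "x = 0"
    then show "lp_norm p x = 0" using True by (simp add: lp_norm_def)
  qed
next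
  case False
  then show ?thesis
    using assms
    by (auto simp: lp_norm_def vec_eq_iff sum_nonneg_eq_0_iff)
qed

lemma lp_norm_triangle:
  fixes x y :: "real ^ 'm"
  assumes "1 \<le> p"
  shows "lp_norm p (x + y) \<le> lp_norm p x + lp_norm p y"
proof (cases "p = \<infinity>")
  case True
  have "\<bar>x $ i + y $ i\<bar> \<le> Max (range (\<lambda>i. \<bar>x $ i\<bar>)) + Max (range (\<lambda>i. \<bar>y $ i\<bar>))" for i
    using abs_triangle_ineq[of "x $ i" "y $ i"] abs_le_Max_component[of x i]
      abs_le_Max_component[of y i] by linarith
  then show ?thesis
    using True by (simp add: lp_norm_def)
next
  case False
  define q where "q = real_of_ereal p"
  have q: "1 \<le> q"
    using assms False unfolding q_def by (cases p) auto
  define a b where "a = lp_norm p x" and "b = lp_norm p y"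
  consider "x = 0" | "y = 0" | "0 < a" "0 < b"
    using lp_norm_nonneg[of p x] lp_norm_nonneg[of p y]
      lp_norm_eq_0_iff[OF assms, of x] lp_norm_eq_0_iff[OF assms, of y]
    unfolding a_def b_def by linarith
  then show ?thesis
  proof cases
    case 1
    then show ?thesis using lp_norm_nonneg[of p x] by simp
  next
    case 2
    then show ?thesis using lp_norm_nonneg[of p y] by simp
  next
    case 3
    define t where "t = a / (a + b)"
    have t: "0 < t" "t < 1" "1 - t = b / (a + b)"
      using 3 by (auto simp: t_def field_simps)
    have sx: "(\<Sum>i\<in>UNIV. (\<bar>x $ i\<bar> / a) powr q) = 1"
    proof -
      have "(\<Sum>i\<in>UNIV. \<bar>x $ i\<bar> powr q) = a powr q"
        using lp_norm_powr[OF assms False, of x] by (simp add: a_def q_def)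
      then show ?thesis
        using 3 by (simp add: powr_divide flip: sum_divide_distrib)
    qed
    have sy: "(\<Sum>i\<in>UNIV. (\<bar>y $ i\<bar> / b) powr q) = 1"
    proof -
      have "(\<Sum>i\<in>UNIV. \<bar>y $ i\<bar> powr q) = b powr q"
        using lp_norm_powr[OF assms False, of y] by (simp add: b_def q_def)
      then show ?thesis
        using 3 by (simp add: powr_divide flip: sum_divide_distrib)
    qed
    have "(\<Sum>i\<in>UNIV. (\<bar>(x + y) $ i\<bar> / (a + b)) powr q)
        \<le> (\<Sum>i\<in>UNIV. t * (\<bar>x $ i\<bar> / a) powr q + (1 - t) * (\<bar>y $ i\<bar> / b) powr q)"
    proof (rule sum_mono)
      fix i :: 'm
      have "\<bar>(x + y) $ i\<bar> / (a + b) \<le> (\<bar>x $ i\<bar> + \<bar>y $ i\<bar>) / (a + b)"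
        using 3 by (intro divide_right_mono) auto
      also have "\<dots> = t * (\<bar>x $ i\<bar> / a) + (1 - t) * (\<bar>y $ i\<bar> / b)"
        unfolding t(3) using 3 by (simp add: t_def add_divide_distrib)
      finally have "(\<bar>(x + y) $ i\<bar> / (a + b)) powr q
          \<le> (t * (\<bar>x $ i\<bar> / a) + (1 - t) * (\<bar>y $ i\<bar> / b)) powr q"
        using q 3 by (intro powr_mono2) auto
      also have "\<dots> \<le> t * (\<bar>x $ i\<bar> / a) powr q + (1 - t) * (\<bar>y $ i\<bar> / b) powr q"
        using q t 3 by (intro powr_convex_nonneg) auto
      finally show "(\<bar>(x + y) $ i\<bar> / (a + b)) powr q
          \<le> t * (\<bar>x $ i\<bar> / a) powr q + (1 - t) * (\<bar>y $ i\<bar> / b) powr q" .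
    qed
    also have "\<dots> = 1"
      by (simp add: sum.distrib sx sy flip: sum_distrib_left)
    finally have "(\<Sum>i\<in>UNIV. \<bar>(x + y) $ i\<bar> powr q) / (a + b) powr q \<le> 1"
      using 3 by (simp add: powr_divide flip: sum_divide_distrib)
    then have "lp_norm p (x + y) powr q \<le> (a + b) powr q"
      using lp_norm_powr[OF assms False, of "x + y"] 3 by (simp add: q_def divide_le_eq)
    then have "lp_norm p (x + y) \<le> a + b"
      using powr_less_mono2[of q "a + b" "lp_norm p (x + y)"] q 3 by linarith
    then show ?thesis by (simp add: a_def b_def)
  qed
qed

lemma Metric_space_lp:
  assumes "1 \<le> p"
  shows "Metric_space UNIV (\<lambda>x y :: real ^ 'm. lp_norm p (x - y))"
proof
  fix x y z :: "real ^ 'm"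
  show "0 \<le> lp_norm p (x - y)"
    by (rule lp_norm_nonneg)
  show "lp_norm p (x - y) = lp_norm p (y - x)"
    by (rule lp_norm_minus_commute)
  show "lp_norm p (x - y) = 0 \<longleftrightarrow> x = y"
    unfolding lp_norm_eq_0_iff[OF assms] by simp
  show "lp_norm p (x - z) \<le> lp_norm p (x - y) + lp_norm p (y - z)"
    using lp_norm_triangle[OF assms, of "x - y" "y - z"] by simp
qed

lemma mspace_lp_metric [simp]: "1 \<le> p \<Longrightarrow> mspace (lp_metric p) = UNIV"
  unfolding lp_metric_def by (rule Metric_space.mspace_metric[OF Metric_space_lp])

lemma mdist_lp_metric [simp]: "1 \<le> p \<Longrightarrow> mdist (lp_metric p) = (\<lambda>x y. lp_norm p (x - y))"
  unfolding lp_metric_def by (rule Metric_space.mdist_metric[OF Metric_space_lp])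


section \<open>Spaces of bounded Lipschitz functions and residual sets\<close>

text \<open>\<^const>\<open>funspace\<close> is the space of bounded functions with the supremum metric.\<close>

definition Lip :: "'b metric \<Rightarrow> real \<Rightarrow> ('a::metric_space \<Rightarrow> 'b) metric"
  where "Lip Y L =
    submetric (funspace UNIV Y) {f. \<forall>x y. mdist Y (f x) (f y) \<le> L * dist x y}"

lemma mspace_Lip_lp_metric:
  assumes "1 \<le> p"
  shows "mspace (Lip (lp_metric p) L) =
    {f. (\<forall>x y. lp_norm p (f x - f y) \<le> L * dist x y) \<and> (\<exists>B. \<forall>x. lp_norm p (f x) \<le> B)}"
proof -
  interpret Metric_space UNIV "\<lambda>x y :: real ^ 'b. lp_norm p (x - y)"
    by (rule Metric_space_lp[OF assms])
  have "mbounded (range f) \<longleftrightarrow> (\<exists>B. \<forall>x. lp_norm p (f x) \<le> B)" for f :: "'a \<Rightarrow> real ^ 'b"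
  proof
    assume "mbounded (range f)"
    then obtain c B where "range f \<subseteq> mcball c B"
      unfolding mbounded_def by blast
    then have B: "lp_norm p (c - f x) \<le> B" for x
      using in_mcball by blast
    have "lp_norm p (f x) \<le> B + lp_norm p c" for x
      using lp_norm_triangle[OF assms, of "f x - c" c] B[of x] lp_norm_minus_commute[of p c "f x"]
      by simp
    then show "\<exists>B. \<forall>x. lp_norm p (f x) \<le> B" by blast
  next
    assume "\<exists>B. \<forall>x. lp_norm p (f x) \<le> B"
    then obtain B where "\<And>x. lp_norm p (f x) \<le> B" by blast
    then have "lp_norm p (0 - f x) \<le> B" for x
      unfolding lp_norm_minus_commute[of p 0 "f x"] by simp
    then have "range f \<subseteq> mcball 0 B"
      by auto
    then show "mbounded (range f)" unfolding mbounded_def by blast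
  qed
  then show ?thesis
    using assms by (auto simp: Lip_def fspace_def)
qed

lemma mdist_Lip_lp_metric:
  assumes "1 \<le> p"
    and "f \<in> mspace (Lip (lp_metric p) L)" "g \<in> mspace (Lip (lp_metric p) L)"
  shows "mdist (Lip (lp_metric p) L) f g = (SUP x. lp_norm p (f x - g x))"
proof -
  interpret Metric_space UNIV "\<lambda>x y :: real ^ 'b. lp_norm p (x - y)"
    by (rule Metric_space_lp[OF assms(1)])
  show ?thesis
    using assms by (simp add: Lip_def fdist_def)
qed

definition residual_in :: "'a topology \<Rightarrow> 'a set \<Rightarrow> bool"
  where "residual_in T A \<longleftrightarrow>
    A \<subseteq> topspace T \<and>
    (\<exists>U :: nat \<Rightarrow> 'a set.
       (\<forall>n. openin T (U n) \<and> T closure_of (U n) = topspace T) \<and> (\<Inter>n. U n) \<subseteq> A)"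

end

theory Submission
  imports Defs "HOL-Complex_Analysis.Great_Picard"
begin

text \<open>
The set \<open>S\<close> is, up to an \<open>\<H>\<^sup>s\<close>-null set, a countable union of compact sets \<open>K\<close> of finite measure
(\<open>hausdorff_inner_compact\<close>), and the image of the null set under a Lipschitz function is null.
So it suffices to treat one compact \<open>K\<close>, and there the sets of functions \<open>f\<close>
such that \<open>f ` K\<close> has a cover by sets of diameter at most \<open>\<nu>\<close> whose diameters, raised to the power
\<open>s\<close>, add up to at most \<open>\<nu>\<close>, should have dense interior. The alternative hypotheses on \<open>s\<close>
and \<open>S\<close> enter through one property of \<open>K\<close>, called \<open>curve_null\<close>: a Lipschitz image inside \<open>K\<close> of a
compact set of reals has length zero. It holds when \<open>S\<close> is purely unrectifiable, and it holds for \<open>s < 1\<close>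
because then \<open>\<H>\<^sup>1\<close> vanishes on \<open>K\<close>.

The heart of the matter is density. A given \<open>f\<close> is replaced by a nearby function \<open>g\<close> that is still
\<open>L\<close>-Lipschitz but is \<open>\<theta>\<close>-Lipschitz, with \<open>\<theta>\<close> tiny, at small scales on \<open>K\<close>
(\<open>vector_flattening\<close>). The image of \<open>K\<close> under \<open>g\<close>, and under every function close to \<open>g\<close>,
then has small Hausdorff content (\<open>hausdorff_pre_image_near_flat\<close>).

For a real function \<open>h\<close>, the function \<open>g\<close> is the value of a shortest path problem (\<open>scalar_flattening\<close>):
\<open>g x\<close> is the infimum of \<open>h x\<^sub>0 + cost\<close> over all finite chains \<open>x\<^sub>0, ..., x\<^sub>n = x\<close> whose points before \<open>x\<close>
lie in \<open>K\<close>. A step from \<open>y\<close> to \<open>z\<close> costs \<open>\<eta> dist y z\<close>, plus the increase of \<open>h\<close> if there is one and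
unless the step is short and stays in \<open>K\<close>. Thus \<open>g\<close> rises along a pair of points no faster than \<open>h\<close>, up
to the slope \<open>\<eta>\<close>, and short steps in \<open>K\<close> have slope at most \<open>\<eta>\<close>. Each coordinate of \<open>f\<close> can be treated
separately: the increments of the coordinates do not grow in absolute value, except for the slope
\<open>\<eta>\<close>, and an \<open>\<ell>\<^sub>p\<close> norm depends monotonically on the absolute values of the coordinates. A scaling by a factor
close to \<open>1\<close> restores the Lipschitz constant \<open>L\<close>.

It remains to see that \<open>g\<close> is close to \<open>h\<close>, that is, that no chain can climb from a low to a high
value of \<open>h\<close> at small cost when the short steps are short enough (\<open>fine_chain_bound\<close>). Otherwise there are
chains of bounded length with ever finer short steps. A value of \<open>h\<close> between the two end values is
passed by some step of the chain, and the values passed by long steps have measure at most the cost.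
So values of measure at least some \<open>\<zeta> > 0\<close> are passed by short steps, and thus are nearly attained by \<open>h\<close>
at a point of the chain. By compactness, a subsequence of the chains, parametrised by length,
converges to a Lipschitz curve fragment in \<open>K\<close> (\<open>lipschitz_graph_limit\<close>), and \<open>h\<close> attains on it a set
of values of measure at least \<open>\<zeta>\<close>. But the fragment has length zero, so its image under the
Lipschitz function \<open>h\<close> is a null set.
\<close>

section \<open>Hausdorff measures as outer measures\<close>

definition hweight :: "('a \<Rightarrow> 'a \<Rightarrow> real) \<Rightarrow> real \<Rightarrow> 'a set \<Rightarrow> ennreal"
  where "hweight d s C = ennreal (enn2real (ediam d C) powr s)"

definition hcover :: "('a \<Rightarrow> 'a \<Rightarrow> real) \<Rightarrow> real \<Rightarrow> 'a set \<Rightarrow> (nat \<Rightarrow> 'a set) \<Rightarrow> bool"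
  where "hcover d \<delta> S C \<longleftrightarrow> S \<subseteq> (\<Union>i. C i) \<and> (\<forall>i. ediam d (C i) \<le> ennreal \<delta>)"

lemma hausdorff_pre_hcover: "hausdorff_pre d s \<delta> S = (INF C \<in> {C. hcover d \<delta> S C}. \<Sum>i. hweight d s (C i))"
  unfolding hausdorff_pre_def hcover_def hweight_def ..

lemma hausdorff_pre_le: "hcover d \<delta> S C \<Longrightarrow> hausdorff_pre d s \<delta> S \<le> (\<Sum>i. hweight d s (C i))"
  unfolding hausdorff_pre_hcover by (rule INF_lower) simp

lemma hausdorff_pre_less:
  assumes "hausdorff_pre d s \<delta> S < e"
  obtains C where "hcover d \<delta> S C" "(\<Sum>i. hweight d s (C i)) < e"
  using assms unfolding hausdorff_pre_hcover INF_less_iff by auto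

lemma ediam_empty [simp]: "ediam d {} = 0"
  by (simp add: ediam_def bot_ennreal)

lemma hweight_empty [simp]: "hweight d s {} = 0"
  by (simp add: hweight_def)

lemma ediam_leI: "(\<And>x y. x \<in> A \<Longrightarrow> y \<in> A \<Longrightarrow> d x y \<le> r) \<Longrightarrow> ediam d A \<le> ennreal r"
  unfolding ediam_def by (intro SUP_least ennreal_leI)

lemma dist_le_ediam:
  assumes "ediam d A \<le> ennreal r" "x \<in> A" "y \<in> A"
  shows "d x y \<le> enn2real (ediam d A)"
proof -
  have "ennreal (d x y) \<le> ediam d A"
    unfolding ediam_def using assms by (intro SUP_upper2[of x] SUP_upper2[of y]) auto
  moreover have "ediam d A < top"
    using assms(1) by (simp add: le_less_trans)
  ultimately show ?thesis
    by (metis enn2real_nonneg ennreal_enn2real ennreal_le_iff)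
qed

lemma enn2real_le_of_le: "x \<le> ennreal r \<Longrightarrow> 0 \<le> r \<Longrightarrow> enn2real x \<le> r"
  by (simp add: enn2real_leI)

lemma hausdorff_pre_mono: "A \<subseteq> B \<Longrightarrow> hausdorff_pre d s \<delta> A \<le> hausdorff_pre d s \<delta> B"
  unfolding hausdorff_pre_hcover hcover_def by (intro INF_superset_mono) auto

lemma hausdorff_pre_empty [simp]: "hausdorff_pre d s \<delta> {} = 0"
  using hausdorff_pre_le[of d \<delta> "{}" "\<lambda>_. {}" s] by (simp add: hcover_def)

lemma hausdorff_pre_UN_le:
  "hausdorff_pre d s \<delta> (\<Union>n. A n) \<le> (\<Sum>n. hausdorff_pre d s \<delta> (A n))"
proof (rule ennreal_le_epsilon)
  let ?O = "hausdorff_pre d s \<delta>"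
  fix e :: real assume "0 < e" "(\<Sum>n. ?O (A n)) < top"
  then have *: "?O (A n) < ?O (A n) + e * (1/2)^Suc n" for n
    by (auto simp add: less_top dest!: ennreal_suminf_lessD)
  have "\<exists>B. hcover d \<delta> (A n) B \<and> (\<Sum>i. hweight d s (B i)) \<le> ?O (A n) + e * (1/2)^Suc n" for n
    using hausdorff_pre_less[OF *[of n]] less_imp_le by metis
  then obtain B where B: "\<And>n. hcover d \<delta> (A n) (B n)"
      "\<And>n. (\<Sum>i. hweight d s (B n i)) \<le> ?O (A n) + e * (1/2)^Suc n"
    by metis
  define C where "C = case_prod B o prod_decode"
  have "x \<in> (\<Union>i. C i)" if "x \<in> A n" for x n
  proof -
    from that B(1)[of n] obtain i where "x \<in> B n i" unfolding hcover_def by blast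
    then have "x \<in> C (prod_encode (n, i))" by (simp add: C_def)
    then show ?thesis by blast
  qed
  then have "hcover d \<delta> (\<Union>n. A n) C"
    using B(1) by (auto simp: hcover_def C_def split_def)
  then have "?O (\<Union>n. A n) \<le> (\<Sum>i. hweight d s (C i))"
    by (rule hausdorff_pre_le)
  also have "\<dots> = (\<Sum>n. \<Sum>i. hweight d s (B n i))"
    unfolding C_def comp_def by (intro suminf_ennreal_2dimen[where f = "\<lambda>p. hweight d s (case_prod B p)"]) auto
  also have "\<dots> \<le> (\<Sum>n. ?O (A n) + e * (1/2) ^ Suc n)"
    by (intro suminf_le allI B(2)) auto
  also have "\<dots> = (\<Sum>n. ?O (A n)) + (\<Sum>n. ennreal e * ennreal ((1/2) ^ Suc n))"
    using \<open>0 < e\<close> by (subst suminf_add[symmetric])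
                     (auto simp del: ennreal_suminf_cmult simp add: ennreal_mult[symmetric])
  also have "\<dots> = (\<Sum>n. ?O (A n)) + e"
    unfolding ennreal_suminf_cmult
    by (subst suminf_ennreal_eq[OF zero_le_power power_half_series]) auto
  finally show "?O (\<Union>n. A n) \<le> (\<Sum>n. ?O (A n)) + e" .
qed

lemma hausdorff_pre_le_hausdorff: "0 < \<delta> \<Longrightarrow> hausdorff_pre d s \<delta> S \<le> hausdorff d s S"
  unfolding hausdorff_eq_SUP by (rule SUP_upper) simp

lemma hausdorff_mono: "A \<subseteq> B \<Longrightarrow> hausdorff d s A \<le> hausdorff d s B"
  unfolding hausdorff_eq_SUP by (intro SUP_mono) (auto intro: hausdorff_pre_mono)

lemma hausdorff_empty [simp]: "hausdorff d s {} = 0"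
  by (simp add: hausdorff_eq_SUP)

lemma hausdorff_UN_le: "hausdorff d s (\<Union>n. A n) \<le> (\<Sum>n. hausdorff d s (A n))"
proof -
  have "hausdorff_pre d s \<delta> (\<Union>n. A n) \<le> (\<Sum>n. hausdorff d s (A n))" if "\<delta> > 0" for \<delta>
  proof -
    have "(\<Sum>n. hausdorff_pre d s \<delta> (A n)) \<le> (\<Sum>n. hausdorff d s (A n))"
      using that by (intro suminf_le allI hausdorff_pre_le_hausdorff) auto
    then show ?thesis using hausdorff_pre_UN_le order_trans by blast
  qed
  then show ?thesis
    unfolding hausdorff_eq_SUP[of d s "\<Union>n. A n"] by (intro SUP_least) auto
qed

lemma hausdorff_UN_null: "(\<And>n. hausdorff d s (A n) = 0) \<Longrightarrow> hausdorff d s (\<Union>n::nat. A n) = 0"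
  using hausdorff_UN_le[of d s A] by simp

lemma hausdorff_Un_le: "hausdorff d s (A \<union> B) \<le> hausdorff d s A + hausdorff d s B"
proof -
  define D where "D n = (if n = 0 then A else if n = 1 then B else {})" for n :: nat
  have "A \<union> B = (\<Union>n. D n)"
    by (auto simp: D_def split: if_splits)
  then have "hausdorff d s (A \<union> B) \<le> (\<Sum>n. hausdorff d s (D n))"
    by (simp add: hausdorff_UN_le)
  also have "\<dots> = (\<Sum>n\<in>{0,1}. hausdorff d s (D n))"
    by (intro suminf_finite) (auto simp: D_def)
  also have "\<dots> = hausdorff d s A + hausdorff d s B" by (simp add: D_def)
  finally show ?thesis .
qed

lemma outer_measure_space_hausdorff: "outer_measure_space UNIV (hausdorff d s)"
  by (auto simp: outer_measure_space_def positive_def increasing_def countably_subadditive_def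
      intro: hausdorff_mono hausdorff_UN_le)

text \<open>A covering set of diameter less than \<open>\<rho>\<close> cannot meet both \<open>A\<close> and \<open>B\<close>, so a fine cover of the union
splits into a cover of \<open>A\<close> and a cover of \<open>B\<close>.\<close>

lemma hausdorff_separated_add:
  fixes A B :: "'a::metric_space set"
  assumes \<rho>: "0 < \<rho>" "\<And>a b. a \<in> A \<Longrightarrow> b \<in> B \<Longrightarrow> \<rho> \<le> dist a b"
  shows "hausdorff dist s A + hausdorff dist s B \<le> hausdorff dist s (A \<union> B)"
proof -
  have pre: "hausdorff_pre dist s \<delta> A + hausdorff_pre dist s \<delta> B \<le> hausdorff_pre dist s \<delta> (A \<union> B)"
    if \<delta>: "0 < \<delta>" "\<delta> < \<rho>" for \<delta>
    unfolding hausdorff_pre_hcover[of dist s \<delta> "A \<union> B"]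
  proof (rule INF_greatest, simp)
    fix C assume C: "hcover dist \<delta> (A \<union> B) C"
    define CA CB where "CA i = (if C i \<inter> A = {} then {} else C i)"
      and "CB i = (if C i \<inter> A = {} then C i else {})" for i
    have *: "C i \<inter> B = {}" if "C i \<inter> A \<noteq> {}" for i
    proof (rule ccontr)
      assume "C i \<inter> B \<noteq> {}"
      with that obtain a b where ab: "a \<in> C i" "a \<in> A" "b \<in> C i" "b \<in> B" by blast
      have le: "ediam dist (C i) \<le> ennreal \<delta>" using C by (simp add: hcover_def)
      have "dist a b \<le> enn2real (ediam dist (C i))"
        using dist_le_ediam[OF le] ab by blast
      also have "\<dots> \<le> \<delta>" using enn2real_le_of_le[OF le] \<delta> by simp
      finally show False using \<rho>(2) ab \<delta> by fastforce
    qed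
    have "hcover dist \<delta> A CA"
      unfolding hcover_def
    proof (intro conjI allI subsetI)
      fix a assume a: "a \<in> A"
      then obtain i where "a \<in> C i" using C by (auto simp: hcover_def)
      with a have "a \<in> CA i" by (auto simp: CA_def)
      then show "a \<in> (\<Union>i. CA i)" by blast
    next
      show "ediam dist (CA i) \<le> ennreal \<delta>" for i
        using C by (simp add: hcover_def CA_def)
    qed
    moreover have "hcover dist \<delta> B CB"
      unfolding hcover_def
    proof (intro conjI allI subsetI)
      fix b assume b: "b \<in> B"
      then obtain i where "b \<in> C i" using C by (auto simp: hcover_def)
      with b * have "b \<in> CB i" by (auto simp: CB_def)
      then show "b \<in> (\<Union>i. CB i)" by blast
    next
      show "ediam dist (CB i) \<le> ennreal \<delta>" for i
        using C by (simp add: hcover_def CB_def)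
    qed
    ultimately have "hausdorff_pre dist s \<delta> A + hausdorff_pre dist s \<delta> B
        \<le> (\<Sum>i. hweight dist s (CA i)) + (\<Sum>i. hweight dist s (CB i))"
      by (intro add_mono hausdorff_pre_le)
    also have "\<dots> = (\<Sum>i. hweight dist s (CA i) + hweight dist s (CB i))"
      by (rule suminf_add) auto
    also have "\<dots> = (\<Sum>i. hweight dist s (C i))"
      by (intro suminf_cong) (simp add: CA_def CB_def)
    finally show "hausdorff_pre dist s \<delta> A + hausdorff_pre dist s \<delta> B \<le> (\<Sum>i. hweight dist s (C i))" .
  qed
  have "hausdorff dist s A + hausdorff dist s B
      = (SUP \<delta>\<in>{0<..}. hausdorff_pre dist s \<delta> A + hausdorff_pre dist s \<delta> B)"
    unfolding hausdorff_eq_SUP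
  proof (rule SUP_add_directed_ennreal[symmetric])
    fix i j :: real assume "i \<in> {0<..}" "j \<in> {0<..}"
    then show "\<exists>k\<in>{0<..}. hausdorff_pre dist s i A + hausdorff_pre dist s j B
        \<le> hausdorff_pre dist s k A + hausdorff_pre dist s k B"
      by (intro bexI[of _ "min i j"] add_mono hausdorff_pre_antimono) auto
  qed
  also have "\<dots> \<le> hausdorff dist s (A \<union> B)"
  proof (rule SUP_least)
    fix \<delta> :: real assume "\<delta> \<in> {0<..}"
    then have \<delta>: "0 < min \<delta> (\<rho>/2)" "min \<delta> (\<rho>/2) < \<rho>" using \<rho> by auto
    have "hausdorff_pre dist s \<delta> A + hausdorff_pre dist s \<delta> B
      \<le> hausdorff_pre dist s (min \<delta> (\<rho>/2)) A + hausdorff_pre dist s (min \<delta> (\<rho>/2)) B"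
      by (intro add_mono hausdorff_pre_antimono) auto
    also have "\<dots> \<le> hausdorff_pre dist s (min \<delta> (\<rho>/2)) (A \<union> B)" by (rule pre[OF \<delta>])
    also have "\<dots> \<le> hausdorff dist s (A \<union> B)" using \<delta> by (intro hausdorff_pre_le_hausdorff)
    finally show "hausdorff_pre dist s \<delta> A + hausdorff_pre dist s \<delta> B \<le> hausdorff dist s (A \<union> B)" .
  qed
  finally show ?thesis .
qed

lemma hausdorff_measurable_iff:
  "hausdorff_measurable s F \<longleftrightarrow> (\<forall>A. hausdorff dist s (A \<inter> F) + hausdorff dist s (A - F) = hausdorff dist s A)"
proof -
  have "(UNIV - F) \<inter> x = x - F" for x :: "'a set" by blast
  then show ?thesis by (simp add: hausdorff_measurable_def lambda_system_def Int_commute)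
qed

text \<open>Caratheodory's argument for outer measures that are additive on separated sets. The part of
\<open>A\<close> at distance at least \<open>1 / (n + 1)\<close> from \<open>F\<close> is separated from \<open>A \<inter> F\<close>. What it misses of \<open>A - F\<close>
is a union of thin rings around \<open>F\<close>. Rings with non-adjacent indices are separated, so the measures of the
rings with even index, and of those with odd index, add up to at most the measure of \<open>A\<close>; the tails of the
series therefore tend to zero.\<close>

lemma hausdorff_measurable_closed:
  fixes F :: "'a::metric_space set"
  assumes "closed F"
  shows "hausdorff_measurable s F"
proof (cases "F = {}")
  case True
  then show ?thesis by (simp add: hausdorff_measurable_iff)
next
  case F: False
  let ?H = "hausdorff dist s"
  have "?H (A \<inter> F) + ?H (A - F) \<le> ?H A" if fin: "?H A < top" for A
  proof (rule ennreal_le_epsilon)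
    fix e :: real assume e: "0 < e"
    define An where "An n = {x\<in>A. 1 / real (n+1) \<le> infdist x F}" for n :: nat
    define R where "R n = {x\<in>A. 1 / real (n+2) \<le> infdist x F \<and> infdist x F < 1 / real (n+1)}" for n :: nat
    have RA: "R n \<subseteq> A" for n by (auto simp: R_def)
    have sep: "x \<in> R m \<Longrightarrow> y \<in> R n \<Longrightarrow> m + 2 \<le> n \<Longrightarrow> 1 / real n - 1 / real (n+1) \<le> dist y x" for x y m n
    proof -
      assume "x \<in> R m" "y \<in> R n" "m + 2 \<le> n"
      moreover have "1 / real n \<le> 1 / real (m+2)" using \<open>m + 2 \<le> n\<close> by (intro divide_left_mono) auto
      ultimately have "1 / real n \<le> infdist x F" "infdist y F < 1 / real (n+1)" by (auto simp: R_def)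
      moreover have "infdist x F \<le> infdist y F + dist x y" by (rule infdist_triangle)
      ultimately show ?thesis by (simp add: dist_commute)
    qed
    have par: "(\<Sum>k<N. ?H (R (2*k+p))) \<le> ?H (\<Union>k<N. R (2*k+p))" for N p
    proof (induction N)
      case (Suc N)
      have "?H (\<Union>k<N. R (2*k+p)) + ?H (R (2*N+p)) \<le> ?H ((\<Union>k<N. R (2*k+p)) \<union> R (2*N+p))"
      proof (cases "N = 0")
        case False
        define n where "n = 2*N+p"
        show ?thesis
        proof (rule hausdorff_separated_add)
          show "0 < 1 / real n - 1 / real (n+1)" using False divide_strict_left_mono[of "real n" "real (n+1)" 1]
            by (auto simp: n_def)
          fix a b assume "a \<in> (\<Union>k<N. R (2*k+p))" "b \<in> R (2*N+p)"
          then obtain k where "k < N" "a \<in> R (2*k+p)" "b \<in> R n" by (auto simp: n_def)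
          then have "1 / real n - 1 / real (n+1) \<le> dist b a" by (intro sep) (auto simp: n_def)
          then show "1 / real n - 1 / real (n+1) \<le> dist a b" by (simp add: dist_commute)
        qed
      qed simp
      with Suc show ?case
        by (auto simp: lessThan_Suc Un_commute add.commute intro: order_trans add_mono)
    qed simp
    have par': "(\<Sum>k<N. ?H (R (2*k+p))) \<le> ?H A" for N p
      by (rule order_trans[OF par hausdorff_mono]) (auto simp: R_def)
    have two: "(\<Sum>k<2*N. ?H (R k)) \<le> ?H A + ?H A" for N
    proof -
      have "(\<Sum>k<2*N. f k) = (\<Sum>k<N. f (2*k+0)) + (\<Sum>k<N. f (2*k+1))" for f :: "nat \<Rightarrow> ennreal"
        by (induction N) (simp_all add: ac_simps)
      then show ?thesis
        using add_mono[OF par'[of 0 N] par'[of 1 N]] by (simp only:)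
    qed
    define r where "r k = enn2real (?H (R k))" for k
    have r: "?H (R k) = ennreal (r k)" for k
      using hausdorff_mono[OF RA, of dist s k] fin by (simp add: r_def ennreal_enn2real le_less_trans)
    have r0: "r k \<ge> 0" for k by (simp add: r_def)
    have "summable r"
    proof (rule summableI_nonneg_bounded[OF r0])
      fix n
      have "(\<Sum>k<n. ?H (R k)) \<le> (\<Sum>k<2*n. ?H (R k))" by (intro sum_mono2) auto
      also note two
      finally have "ennreal (\<Sum>k<n. r k) \<le> ?H A + ?H A" using r r0 by (simp add: sum_ennreal)
      moreover have "?H A + ?H A < top" using fin by simp
      ultimately show "sum r {..<n} \<le> enn2real (?H A + ?H A)"
        by (metis enn2real_nonneg ennreal_enn2real ennreal_le_iff)
    qed
    from suminf_exist_split[OF e this] obtain n where n: "norm (\<Sum>k. r (k+n)) < e" by blast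
    have "A - F \<subseteq> An n \<union> (\<Union>k. R (k+n))"
    proof
      fix x assume x: "x \<in> A - F"
      then have pos: "0 < infdist x F" using assms F by (intro infdist_pos_not_in_closed) auto
      show "x \<in> An n \<union> (\<Union>k. R (k+n))"
      proof (cases "x \<in> An n")
        case False
        then have lt: "infdist x F < 1 / real (n+1)" using x by (auto simp: An_def)
        obtain m0 where m0: "1 / real (Suc m0) < infdist x F" using nat_approx_posE[OF pos] by blast
        define m where "m = (LEAST m. 1 / real (m+1) \<le> infdist x F)"
        have m1: "1 / real (m+1) \<le> infdist x F" unfolding m_def
          by (rule LeastI[of _ m0]) (use m0 in auto)
        have "n < m"
        proof (rule ccontr)
          assume "\<not> n < m"
          then have "1 / real (n+1) \<le> 1 / real (m+1)" by (intro divide_left_mono) auto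
          with m1 lt show False by simp
        qed
        then obtain k where k: "m = Suc (k + n)" using less_iff_Suc_add by (auto simp: add.commute)
        have "\<not> 1 / real (k + n +1) \<le> infdist x F"
          using not_less_Least[of "k+n" "\<lambda>m. 1 / real (m+1) \<le> infdist x F"] k by (simp add: m_def)
        then have "x \<in> R (k+n)" using x m1 k by (auto simp: R_def)
        then show ?thesis by blast
      qed simp
    qed
    then have "?H (A - F) \<le> ?H (An n \<union> (\<Union>k. R (k+n)))" by (rule hausdorff_mono)
    also have "\<dots> \<le> ?H (An n) + ?H (\<Union>k. R (k+n))" by (rule hausdorff_Un_le)
    also have "\<dots> \<le> ?H (An n) + ennreal e"
    proof (rule add_left_mono)
      have "?H (\<Union>k. R (k+n)) \<le> (\<Sum>k. ?H (R (k+n)))" by (rule hausdorff_UN_le)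
      also have "\<dots> = ennreal (\<Sum>k. r (k+n))" unfolding r
        using r0 \<open>summable r\<close> by (intro suminf_ennreal2) (auto simp: summable_iff_shift)
      also have "\<dots> \<le> ennreal e" using n by (intro ennreal_leI) auto
      finally show "?H (\<Union>k. R (k+n)) \<le> ennreal e" .
    qed
    finally have "?H (A \<inter> F) + ?H (A - F) \<le> (?H (A \<inter> F) + ?H (An n)) + ennreal e"
      by (simp add: add.assoc add_left_mono)
    also have "?H (A \<inter> F) + ?H (An n) \<le> ?H ((A \<inter> F) \<union> An n)"
    proof (rule hausdorff_separated_add)
      show "0 < 1 / real (n+1)" by simp
      fix a b assume "a \<in> A \<inter> F" "b \<in> An n"
      then have "1 / real (n+1) \<le> infdist b F" "a \<in> F" by (auto simp: An_def)
      moreover from \<open>a \<in> F\<close> have "infdist b F \<le> dist b a" by (rule infdist_le)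
      ultimately show "1 / real (n+1) \<le> dist a b" by (simp add: dist_commute)
    qed
    also have "\<dots> \<le> ?H A" by (intro hausdorff_mono) (auto simp: An_def)
    finally show "?H (A \<inter> F) + ?H (A - F) \<le> ?H A + ennreal e" by (simp add: add_right_mono)
  qed
  then have "?H (A \<inter> F) + ?H (A - F) \<le> ?H A" for A by (cases "?H A = top") (auto simp: less_top)
  moreover have "?H A \<le> ?H (A \<inter> F) + ?H (A - F)" for A
    using hausdorff_Un_le[of dist s "A \<inter> F" "A - F"] by (simp add: Int_Diff_Un)
  ultimately show ?thesis by (auto simp: hausdorff_measurable_iff intro: antisym)
qed

section \<open>Inner regularity\<close>

definition hausdorff_space :: "real \<Rightarrow> 'a::metric_space measure"
  where "hausdorff_space s = measure_of UNIV {A. hausdorff_measurable s A} (hausdorff dist s)"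

lemma hausdorff_space:
  shows space_hausdorff_space [simp]: "space (hausdorff_space s) = (UNIV :: 'a::metric_space set)"
    and sets_hausdorff_space: "sets (hausdorff_space s) = {A :: 'a set. hausdorff_measurable s A}"
    and emeasure_hausdorff_space: "hausdorff_measurable s (A :: 'a set) \<Longrightarrow> emeasure (hausdorff_space s) A = hausdorff dist s A"
proof -
  interpret sigma_algebra "UNIV :: 'a set" UNIV
    using sigma_algebra_Pow[of "UNIV :: 'a set"] by simp
  have "measure_space UNIV {A :: 'a set. hausdorff_measurable s A} (hausdorff dist s)"
    using caratheodory_lemma[OF outer_measure_space_hausdorff, of dist s]
    by (simp add: hausdorff_measurable_def)
  then have *: "sigma_algebra UNIV {A :: 'a set. hausdorff_measurable s A}"
      "positive {A :: 'a set. hausdorff_measurable s A} (hausdorff dist s)"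
      "countably_additive {A :: 'a set. hausdorff_measurable s A} (hausdorff dist s)"
    by (auto simp: measure_space_def)
  show "space (hausdorff_space s) = (UNIV :: 'a set)"
    by (simp add: hausdorff_space_def space_measure_of_conv)
  show "sets (hausdorff_space s) = {A :: 'a set. hausdorff_measurable s A}"
    unfolding hausdorff_space_def by (rule sigma_algebra.sets_measure_of_eq[OF *(1)])
  show "emeasure (hausdorff_space s) A = hausdorff dist s A" if "hausdorff_measurable s A"
    unfolding hausdorff_space_def by (rule emeasure_measure_of_sigma[OF *]) (use that in simp)
qed

lemma hweight_mono:
  assumes "ediam d A \<le> ediam d' B" "ediam d' B \<le> ennreal \<delta>" "0 \<le> s"
  shows "hweight d s A \<le> hweight d' s B"
  unfolding hweight_def using assms
  by (intro ennreal_leI powr_mono2 enn2real_mono) (auto simp: le_less_trans)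

lemma ediam_closure_le:
  fixes A :: "'a::metric_space set"
  assumes "ediam dist A \<le> ennreal \<delta>"
  shows "ediam dist (closure A) \<le> ediam dist A"
proof -
  define r where "r = enn2real (ediam dist A)"
  have r: "ediam dist A = ennreal r"
    unfolding r_def using assms by (simp add: ennreal_enn2real le_less_trans)
  have A: "dist x y \<le> r" if "x \<in> A" "y \<in> A" for x y
    unfolding r_def by (rule dist_le_ediam[OF assms that])
  have 1: "dist x y \<le> r" if "x \<in> A" "y \<in> closure A" for x y
  proof -
    have "A \<subseteq> cball x r" using A that by auto
    then have "closure A \<subseteq> cball x r" by (rule closure_minimal) simp
    then show ?thesis using that by auto
  qed
  have "dist x y \<le> r" if "x \<in> closure A" "y \<in> closure A" for x y
  proof -
    have "A \<subseteq> cball x r" using 1 that by (auto simp: dist_commute)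
    then have "closure A \<subseteq> cball x r" by (rule closure_minimal) simp
    then show ?thesis using that by auto
  qed
  then show ?thesis unfolding r by (rule ediam_leI)
qed

lemma hausdorff_closed_cover:
  fixes S :: "'a::metric_space set"
  assumes "0 \<le> s" "hausdorff dist s S < \<infinity>" "0 < \<delta>" "0 < (e::real)"
  obtains C where "hcover dist \<delta> S C" "\<And>i. closed (C i)"
    "(\<Sum>i. hweight dist s (C i)) \<le> hausdorff dist s S + e"
proof -
  have "hausdorff_pre dist s \<delta> S \<le> hausdorff dist s S"
    by (rule hausdorff_pre_le_hausdorff) fact
  also have "\<dots> < hausdorff dist s S + e"
    using assms by (cases "hausdorff dist s S") (auto simp: ennreal_less_iff simp flip: ennreal_plus)
  finally obtain C where C: "hcover dist \<delta> S C" "(\<Sum>i. hweight dist s (C i)) < hausdorff dist s S + e"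
    using hausdorff_pre_less by blast
  have le: "ediam dist (closure (C i)) \<le> ediam dist (C i)" "ediam dist (C i) \<le> ennreal \<delta>" for i
    using C(1) ediam_closure_le by (auto simp: hcover_def)
  show thesis
  proof
    show "hcover dist \<delta> S (\<lambda>i. closure (C i))"
      unfolding hcover_def
    proof (intro conjI allI)
      show "S \<subseteq> (\<Union>i. closure (C i))"
        using C(1) closure_subset unfolding hcover_def by blast
    qed (use le order_trans in blast)
    have "(\<Sum>i. hweight dist s (closure (C i))) \<le> (\<Sum>i. hweight dist s (C i))"
      using le assms(1) by (intro suminf_le allI hweight_mono) auto
    then show "(\<Sum>i. hweight dist s (closure (C i))) \<le> hausdorff dist s S + e"
      using C(2) by (meson less_imp_le order_trans)
  qed simp
qed

text \<open>Each set of a closed cover is fattened by a radius \<open>t i\<close>; since \<open>r \<mapsto> r powr s\<close> is continuous at zero as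
well for \<open>s > 0\<close>, the radii can be chosen so that the total weight grows by at most \<open>e / 2\<close>.\<close>

lemma hausdorff_open_cover:
  fixes S :: "'a::metric_space set"
  assumes s: "0 < s" and fin: "hausdorff dist s S < \<infinity>" and "0 < \<delta>" "0 < (e::real)"
  obtains C where "hcover dist \<delta> S C" "\<And>i. open (C i)"
    "(\<Sum>i. hweight dist s (C i)) \<le> hausdorff dist s S + e"
proof -
  obtain C where C: "hcover dist (\<delta>/2) S C" "(\<Sum>i. hweight dist s (C i)) \<le> hausdorff dist s S + ennreal (e/2)"
    using hausdorff_closed_cover[of s S "\<delta>/2" "e/2"] assms by auto
  define r where "r i = enn2real (ediam dist (C i))" for i
  have le: "ediam dist (C i) \<le> ennreal (\<delta>/2)" for i using C(1) by (simp add: hcover_def)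
  have r: "0 \<le> r i" "r i \<le> \<delta>/2" for i
    using enn2real_le_of_le[OF le, of i] assms by (auto simp: r_def)
  have rd: "dist x y \<le> r i" if "x \<in> C i" "y \<in> C i" for x y i
    unfolding r_def by (rule dist_le_ediam[OF le that])
  have "\<exists>t>0. 2 * t \<le> \<delta>/2 \<and> (r i + 2*t) powr s \<le> r i powr s + e/2 * (1/2)^Suc i" for i
  proof -
    have "((\<lambda>t. (r i + 2*t) powr s) \<longlongrightarrow> (r i + 2*0) powr s) (at_right 0)"
      using r s by (intro tendsto_powr' tendsto_intros)
        (auto intro!: eventually_at_rightI[of 0 1])
    then have "\<forall>\<^sub>F t in at_right 0. (r i + 2*t) powr s < r i powr s + e/2 * (1/2)^Suc i"
      using assms by (intro order_tendstoD(2)) auto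
    moreover have "\<forall>\<^sub>F t in at_right 0. 2 * t \<le> \<delta>/2"
      using assms by (intro eventually_at_rightI[of 0 "\<delta>/4"]) auto
    moreover have "\<forall>\<^sub>F t in at_right 0. (0::real) < t" by (rule eventually_at_right_less)
    ultimately have "\<forall>\<^sub>F t in at_right 0. t > 0 \<and> 2 * t \<le> \<delta>/2 \<and> (r i + 2*t) powr s \<le> r i powr s + e/2 * (1/2)^Suc i"
      by eventually_elim auto
    then show ?thesis using eventually_happens'[of "at_right (0::real)"] by force
  qed
  then obtain t where t: "\<And>i. t i > 0" "\<And>i. 2 * t i \<le> \<delta>/2"
      "\<And>i. (r i + 2 * t i) powr s \<le> r i powr s + e/2 * (1/2)^Suc i"
    by metis
  define U where "U i = (\<Union>x\<in>C i. ball x (t i))" for i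
  have U: "ediam dist (U i) \<le> ennreal (r i + 2 * t i)" for i
  proof (rule ediam_leI)
    fix x y assume "x \<in> U i" "y \<in> U i"
    then obtain a b where "a \<in> C i" "dist a x < t i" "b \<in> C i" "dist b y < t i" by (auto simp: U_def)
    moreover have "dist x y \<le> dist a x + dist a b + dist b y"
      using dist_triangle[of x y a] dist_triangle[of a y b] by (simp add: dist_commute)
    ultimately show "dist x y \<le> r i + 2 * t i" using rd[of a i b] by linarith
  qed
  show thesis
  proof
    have "ennreal (r i + 2 * t i) \<le> ennreal \<delta>" for i
      using t(2)[of i] r(2)[of i] by (intro ennreal_leI) linarith
    moreover have "S \<subseteq> (\<Union>i. U i)"
    proof
      fix x assume "x \<in> S"
      then obtain i where "x \<in> C i" using C(1) by (auto simp: hcover_def)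
      then have "x \<in> U i" using t(1)[of i] by (force simp: U_def)
      then show "x \<in> (\<Union>i. U i)" by blast
    qed
    ultimately show "hcover dist \<delta> S U"
      using U order_trans unfolding hcover_def by blast
    show "open (U i)" for i by (auto simp: U_def)
    have "hweight dist s (U i) \<le> hweight dist s (C i) + ennreal (e/2) * ennreal ((1/2)^Suc i)" for i
    proof -
      have "enn2real (ediam dist (U i)) \<le> r i + 2 * t i"
        by (rule enn2real_le_of_le[OF U]) (use r(1)[of i] t(1)[of i] in simp)
      then have "enn2real (ediam dist (U i)) powr s \<le> (r i + 2 * t i) powr s"
        using s by (intro powr_mono2) auto
      also note t(3)
      finally have "hweight dist s (U i) \<le> ennreal (r i powr s + e/2 * (1/2)^Suc i)"
        unfolding hweight_def by (rule ennreal_leI)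
      also have "\<dots> = hweight dist s (C i) + ennreal (e/2) * ennreal ((1/2)^Suc i)"
        unfolding hweight_def r_def using assms
        by (subst ennreal_plus) (auto simp del: power_Suc simp flip: ennreal_mult)
      finally show ?thesis .
    qed
    then have "(\<Sum>i. hweight dist s (U i)) \<le> (\<Sum>i. hweight dist s (C i) + ennreal (e/2) * ennreal ((1/2)^Suc i))"
      by (intro suminf_le allI) auto
    also have "\<dots> = (\<Sum>i. hweight dist s (C i)) + (\<Sum>i. ennreal (e/2) * ennreal ((1/2)^Suc i))"
      by (rule suminf_add[symmetric]) auto
    also have "\<dots> = (\<Sum>i. hweight dist s (C i)) + ennreal (e/2)"
      unfolding ennreal_suminf_cmult
      by (subst suminf_ennreal_eq[OF zero_le_power power_half_series]) auto
    also have "\<dots> \<le> hausdorff dist s S + ennreal (e/2) + ennreal (e/2)"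
      by (intro add_right_mono C(2))
    also have "\<dots> = hausdorff dist s S + e"
      using assms by (simp add: add.assoc flip: ennreal_plus)
    finally show "(\<Sum>i. hweight dist s (U i)) \<le> hausdorff dist s S + e" .
  qed
qed

lemma hausdorff_le_of_covers:
  assumes "\<And>\<delta> e. 0 < \<delta> \<Longrightarrow> 0 < e \<Longrightarrow> \<exists>C. hcover d \<delta> S C \<and> (\<Sum>i. hweight d s (C i)) \<le> m + ennreal e"
  shows "hausdorff d s S \<le> m"
  unfolding hausdorff_eq_SUP
proof (rule SUP_least)
  fix \<delta> :: real assume \<delta>: "\<delta> \<in> {0<..}"
  show "hausdorff_pre d s \<delta> S \<le> m"
  proof (rule ennreal_le_epsilon)
    fix e :: real assume "0 < e"
    then obtain C where "hcover d \<delta> S C" "(\<Sum>i. hweight d s (C i)) \<le> m + e" using assms \<delta> by auto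
    then show "hausdorff_pre d s \<delta> S \<le> m + e" using hausdorff_pre_le order_trans by blast
  qed
qed

lemma hcover_mono: "hcover d \<delta> S C \<Longrightarrow> S' \<subseteq> (\<Union>i. C i) \<Longrightarrow> \<delta> \<le> \<delta>' \<Longrightarrow> hcover d \<delta>' S' C"
  unfolding hcover_def using ennreal_leI order_trans by blast

lemma decseq_small:
  assumes "\<And>n. A n \<in> sets M" "decseq A" "emeasure M (A 0) < \<infinity>" "emeasure M (\<Inter>n. A n) = 0" "0 < (e::real)"
  obtains n where "emeasure M (A n) < e"
proof -
  have "emeasure M (A i) \<noteq> \<infinity>" for i
    using assms(3) emeasure_mono[of "A i" "A 0" M] assms(1,2) decseqD[of A 0 i]
    by (auto simp: top_unique)
  then have "(\<lambda>n. emeasure M (A n)) \<longlonglongrightarrow> emeasure M (\<Inter>n. A n)"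
    using assms by (intro Lim_emeasure_decseq) auto
  then have "\<forall>\<^sub>F n in sequentially. emeasure M (A n) < e"
    using assms by (intro order_tendstoD(2)) auto
  then show thesis using that eventually_happens'[OF sequentially_bot] by blast
qed

text \<open>For every \<open>n\<close>, finitely many closed sets of diameter at most \<open>1 / (n + 1)\<close> cover \<open>T\<close> up to a small part.
The intersection \<open>C1\<close> of these finite unions is closed and totally bounded, hence compact, and contains most
of \<open>T\<close>; it has finite measure because it inherits the covers of \<open>T\<close>. The superfluous part \<open>R = C1 - T\<close> has
the same measure as the intersection \<open>B\<close> of \<open>C1\<close> with suitable open sets \<open>V n\<close> containing \<open>R\<close>. As \<open>T\<close> is
measurable, \<open>B \<inter> T\<close> is null, so removing the intersection of finitely many \<open>V n\<close> from \<open>C1\<close> costs little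
and leaves a compact subset of \<open>T\<close>.\<close>

lemma hausdorff_inner_compact:
  fixes T :: "'a::complete_space set"
  assumes s: "0 < s" and T: "hausdorff_measurable s T" and fin: "hausdorff dist s T < \<infinity>" and e: "0 < (e::real)"
  obtains C where "compact C" "C \<subseteq> T" "hausdorff dist s (T - C) \<le> e"
proof -
  let ?H = "hausdorff dist s" and ?M = "hausdorff_space s :: 'a measure"
  have TM [measurable]: "T \<in> sets ?M" using T by (simp add: sets_hausdorff_space)
  have closedM: "closed F \<Longrightarrow> F \<in> sets ?M" for F
    by (simp add: sets_hausdorff_space hausdorff_measurable_closed)
  have openM: "open F \<Longrightarrow> F \<in> sets ?M" for F
    using sets.compl_sets[OF closedM[of "- F"]] by (simp add: closed_Compl Diff_eq)
  have em: "emeasure ?M A = ?H A" if "A \<in> sets ?M" for A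
    using that by (simp add: sets_hausdorff_space emeasure_hausdorff_space)
  have "\<forall>n::nat. \<exists>F. hcover dist (1 / real (n+1)) T F \<and> (\<forall>i. closed (F i))
      \<and> (\<Sum>i. hweight dist s (F i)) \<le> ?H T + ennreal 1"
    using hausdorff_closed_cover[of s T _ 1] s fin by (metis less_imp_le of_nat_0_less_iff zero_less_divide_1_iff zero_less_one Suc_eq_plus1 zero_less_Suc)
  then obtain F where F: "\<And>n. hcover dist (1 / real (n+1)) T (F n)" "\<And>n i. closed (F n i)"
      "\<And>n. (\<Sum>i. hweight dist s (F n i)) \<le> ?H T + ennreal 1"
    by metis
  have [measurable]: "F n i \<in> sets ?M" for n i using F(2) closedM by blast
  have "\<exists>k. ?H (T - (\<Union>i<k. F n i)) \<le> ennreal (e/2) * ennreal ((1/2)^Suc n)" for n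
  proof -
    define A where "A k = T - (\<Union>i<k. F n i)" for k
    have AM: "A k \<in> sets ?M" for k unfolding A_def by measurable
    have "(\<Inter>k. A k) = {}"
      using F(1)[of n] unfolding A_def hcover_def by fastforce
    moreover have "decseq A" unfolding A_def decseq_def by fastforce
    moreover have "emeasure ?M (A 0) < \<infinity>" using fin em[OF TM] by (simp add: A_def)
    ultimately obtain k where "emeasure ?M (A k) < ennreal (e/2 * (1/2)^Suc n)"
      using decseq_small[of A ?M "e/2 * (1/2)^Suc n"] AM e by auto
    then have "?H (A k) \<le> ennreal (e/2) * ennreal ((1/2)^Suc n)"
      using e em[OF AM] by (auto simp del: power_Suc simp flip: ennreal_mult)
    then show ?thesis by (auto simp: A_def)
  qed
  then obtain k where k: "\<And>n. ?H (T - (\<Union>i<k n. F n i)) \<le> ennreal (e/2) * ennreal ((1/2)^Suc n)"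
    by metis
  define C1 where "C1 = (\<Inter>n. \<Union>i<k n. F n i)"
  have C1cl: "closed C1" unfolding C1_def using F(2) by (intro closed_INT ballI closed_UN) auto
  have [measurable]: "C1 \<in> sets ?M" using C1cl closedM by blast
  have "?H (T - C1) \<le> ?H (\<Union>n. T - (\<Union>i<k n. F n i))"
    by (rule hausdorff_mono) (auto simp: C1_def)
  also have "\<dots> \<le> (\<Sum>n. ?H (T - (\<Union>i<k n. F n i)))" by (rule hausdorff_UN_le)
  also have "\<dots> \<le> (\<Sum>n. ennreal (e/2) * ennreal ((1/2)^Suc n))"
    by (intro suminf_le allI k) auto
  also have "\<dots> = ennreal (e/2)"
    unfolding ennreal_suminf_cmult
    by (subst suminf_ennreal_eq[OF zero_le_power power_half_series]) auto
  finally have TC1: "?H (T - C1) \<le> ennreal (e/2)" .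
  have "compact C1"
    unfolding compact_eq_totally_bounded
  proof (intro conjI allI impI)
    show "complete C1" using C1cl by (simp add: complete_eq_closed)
    fix r :: real assume "0 < r"
    then obtain n where n: "1 / real (Suc n) < r" using nat_approx_posE by blast
    define p where "p i = (SOME x. x \<in> F n i)" for i
    have "C1 \<subseteq> (\<Union>x\<in>p ` {..<k n}. ball x r)"
    proof
      fix x assume "x \<in> C1"
      then obtain i where i: "i < k n" "x \<in> F n i" by (auto simp: C1_def)
      then have "p i \<in> F n i" unfolding p_def by (metis someI)
      have le: "ediam dist (F n i) \<le> ennreal (1 / real (n+1))" using F(1)[of n] by (simp add: hcover_def)
      have "dist (p i) x \<le> enn2real (ediam dist (F n i))"
        by (rule dist_le_ediam[OF le]) fact+
      also have "\<dots> \<le> 1 / real (n+1)" by (rule enn2real_le_of_le[OF le]) simp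
      finally have "x \<in> ball (p i) r" using n by simp
      then show "x \<in> (\<Union>x\<in>p ` {..<k n}. ball x r)" using i by blast
    qed
    then show "\<exists>K. finite K \<and> C1 \<subseteq> (\<Union>x\<in>K. ball x r)" by blast
  qed
  define m where "m = ?H T + ennreal 1"
  have "?H C1 \<le> m"
  proof (rule hausdorff_le_of_covers)
    fix \<delta> e' :: real assume "0 < \<delta>" "0 < e'"
    then obtain n where n: "1 / real (Suc n) < \<delta>" using nat_approx_posE by blast
    have "hcover dist \<delta> C1 (F n)"
      by (rule hcover_mono[OF F(1)]) (use n in \<open>auto simp: C1_def\<close>)
    then show "\<exists>C. hcover dist \<delta> C1 C \<and> (\<Sum>i. hweight dist s (C i)) \<le> m + ennreal e'"
      using F(3)[of n] by (intro exI[of _ "F n"]) (simp add: m_def add_increasing2)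
  qed
  also have "\<dots> < \<infinity>" using fin by (simp add: m_def)
  finally have finC1: "?H C1 < \<infinity>" .
  define R where "R = C1 - T"
  have [measurable]: "R \<in> sets ?M" unfolding R_def by measurable
  have finR: "?H R < \<infinity>" by (rule le_less_trans[OF hausdorff_mono finC1]) (auto simp: R_def)
  have "\<forall>n::nat. \<exists>U. hcover dist (1 / real (n+1)) R U \<and> (\<forall>i. open (U i))
      \<and> (\<Sum>i. hweight dist s (U i)) \<le> ?H R + ennreal (1 / real (n+1))"
    using hausdorff_open_cover[of s R] s finR by (metis of_nat_0_less_iff zero_less_divide_1_iff Suc_eq_plus1 zero_less_Suc)
  then obtain U where U: "\<And>n. hcover dist (1 / real (n+1)) R (U n)" "\<And>n i. open (U n i)"
      "\<And>n. (\<Sum>i. hweight dist s (U n i)) \<le> ?H R + ennreal (1 / real (n+1))"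
    by metis
  define V where "V n = (\<Union>i. U n i)" for n
  have V: "open (V n)" "R \<subseteq> V n" for n
    using U(1)[of n] U(2) by (auto simp: V_def hcover_def)
  have [measurable]: "V n \<in> sets ?M" for n using V openM by blast
  define B where "B = C1 \<inter> (\<Inter>n. V n)"
  have BM [measurable]: "B \<in> sets ?M" unfolding B_def by measurable
  have "?H B \<le> ?H R"
  proof (rule hausdorff_le_of_covers)
    fix \<delta> e' :: real assume "0 < \<delta>" "0 < e'"
    then obtain n where n: "1 / real (Suc n) < min \<delta> e'" using nat_approx_posE[of "min \<delta> e'"] by auto
    have "hcover dist \<delta> B (U n)"
      by (rule hcover_mono[OF U(1)]) (use n in \<open>auto simp: B_def V_def\<close>)
    moreover have "?H R + ennreal (1 / real (n+1)) \<le> ?H R + ennreal e'"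
      using n by (intro add_left_mono ennreal_leI) auto
    ultimately show "\<exists>C. hcover dist \<delta> B C \<and> (\<Sum>i. hweight dist s (C i)) \<le> ?H R + ennreal e'"
      using U(3)[of n] order_trans by blast
  qed
  also have "?H R \<le> ?H (B - T)"
    using V(2) by (intro hausdorff_mono) (auto simp: B_def R_def)
  finally have "?H (B \<inter> T) + ?H (B - T) \<le> ?H (B - T)"
    using T by (simp add: hausdorff_measurable_iff)
  moreover have "?H (B - T) < \<infinity>"
    by (rule le_less_trans[OF hausdorff_mono finC1]) (auto simp: B_def)
  ultimately have BT: "?H (B \<inter> T) = 0"
    by (cases "?H (B - T)"; cases "?H (B \<inter> T)") (auto simp: top_unique simp flip: ennreal_plus)
  define Q where "Q n = C1 \<inter> T \<inter> (\<Inter>m\<le>n. V m)" for n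
  have QM: "Q n \<in> sets ?M" for n unfolding Q_def by measurable
  have "(\<Inter>n. Q n) = B \<inter> T" by (auto simp: Q_def B_def)
  then have "emeasure ?M (\<Inter>n. Q n) = 0" using BT em[of "B \<inter> T"] by simp
  moreover have "decseq Q" unfolding Q_def decseq_def by fastforce
  moreover have "emeasure ?M (Q 0) < \<infinity>"
    unfolding em[OF QM] by (rule le_less_trans[OF hausdorff_mono finC1]) (auto simp: Q_def)
  ultimately obtain n where n: "emeasure ?M (Q n) < ennreal (e/2)"
    using decseq_small[of Q ?M "e/2"] QM e by auto
  define C where "C = C1 - (\<Inter>m\<le>n. V m)"
  show thesis
  proof
    have "open (\<Inter>m\<le>n. V m)" using V by (intro open_INT) auto
    then show "compact C" unfolding C_def by (rule compact_diff[OF \<open>compact C1\<close>])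
    show "C \<subseteq> T" using V(2) by (auto simp: C_def R_def)
    have "?H (T - C) \<le> ?H ((T - C1) \<union> Q n)" by (rule hausdorff_mono) (auto simp: C_def Q_def)
    also have "\<dots> \<le> ?H (T - C1) + ?H (Q n)" by (rule hausdorff_Un_le)
    also have "\<dots> \<le> ennreal (e/2) + ennreal (e/2)"
      using TC1 n em[OF QM] by (intro add_mono) auto
    also have "\<dots> = ennreal e" using e by (simp flip: ennreal_plus)
    finally show "?H (T - C) \<le> e" .
  qed
qed

section \<open>Limits of fine chains\<close>

text \<open>A selection theorem of Blaschke type for graphs of \<open>1\<close>-Lipschitz functions on subsets of
\<open>{0..\<Lambda>}\<close>. The distance functions of the sets \<open>G n\<close> are \<open>1\<close>-Lipschitz on the compact set \<open>P\<close>, so a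
subsequence that converges on a countable dense set converges everywhere; the limit graph is the zero
set of the limit function. Because the full subsequence converges, every limit of points taken from
infinitely many of the graphs belongs to the limit graph.\<close>

lemma lipschitz_graph_limit:
  fixes G :: "nat \<Rightarrow> (real \<times> 'a::metric_space) set"
  assumes K: "compact K" and ne: "\<And>n. G n \<noteq> {}" and G: "\<And>n. G n \<subseteq> {0..\<Lambda>} \<times> K"
    and lip: "\<And>n p q. p \<in> G n \<Longrightarrow> q \<in> G n \<Longrightarrow> dist (snd p) (snd q) \<le> dist (fst p) (fst q)"
  obtains r :: "nat \<Rightarrow> nat" and A and \<gamma> :: "real \<Rightarrow> 'a"
  where "strict_mono r" "compact A" "1-lipschitz_on A \<gamma>" "\<gamma> ` A \<subseteq> K"
    "\<forall>\<sigma> x l. strict_mono (\<sigma> :: nat \<Rightarrow> nat) \<longrightarrow> (\<forall>k. x k \<in> snd ` G (r (\<sigma> k))) \<longrightarrow> x \<longlonglongrightarrow> l \<longrightarrow> l \<in> \<gamma> ` A"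
proof -
  define P where "P = {0..\<Lambda>} \<times> K"
  have P: "compact P" unfolding P_def using K by (intro compact_Times) auto
  have GP: "G n \<subseteq> P" for n using G by (simp add: P_def)
  have "\<forall>n::nat. \<exists>k. finite k \<and> k \<subseteq> P \<and> P \<subseteq> (\<Union>x\<in>k. ball x (1 / real (Suc n)))"
    using seq_compact_imp_totally_bounded[OF compact_imp_seq_compact[OF P]] by simp
  then obtain k where k: "\<And>n. finite (k n)" "\<And>n. k n \<subseteq> P" "\<And>n. P \<subseteq> (\<Union>x\<in>k n. ball x (1 / real (Suc n)))"
    by metis
  define D where "D = (\<Union>n. k n)"
  have D: "countable D" "D \<subseteq> P"
    using k by (auto simp: D_def intro: countable_finite)
  have dense: "\<exists>q\<in>D. dist p q < e" if "p \<in> P" "0 < e" for p e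
  proof -
    obtain n where n: "1 / real (Suc n) < e" using nat_approx_posE[OF \<open>0 < e\<close>] by blast
    from k(3)[of n] that obtain q where "q \<in> k n" "dist q p < 1 / real (Suc n)" by auto
    then show ?thesis using n by (auto simp: D_def dist_commute intro!: bexI[of _ q])
  qed
  define F where "F n p = infdist p (G n)" for n p
  have F1: "\<bar>F n p - F n q\<bar> \<le> dist p q" for n p q
    unfolding F_def by (rule infdist_triangle_abs)
  have F0: "0 \<le> F n p" for n p by (simp add: F_def infdist_nonneg)
  have bnd: "norm (F n p) \<le> diameter P" if "p \<in> D" for n p
  proof -
    from ne obtain g where g: "g \<in> G n" by blast
    have "infdist p (G n) \<le> dist p g" using g by (rule infdist_le)
    also have "\<dots> \<le> diameter P"
      using that D g GP[of n] by (intro diameter_bounded_bound compact_imp_bounded P) auto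
    finally show ?thesis using F0[of n p] by (simp add: F_def)
  qed
  obtain r where r: "strict_mono r" "\<And>p. p \<in> D \<Longrightarrow> \<exists>l. (\<lambda>n. F (r n) p) \<longlonglongrightarrow> l"
    using function_convergent_subsequence[OF D(1), of F "diameter P"] bnd by metis
  have conv: "convergent (\<lambda>n. F (r n) p)" if pP: "p \<in> P" for p
  proof -
    have "Cauchy (\<lambda>n. F (r n) p)"
    proof (rule metric_CauchyI)
      fix e :: real assume e: "0 < e"
      then obtain q where q: "q \<in> D" "dist p q < e/3" using dense[OF pP, of "e/3"] by auto
      from r(2)[OF q(1)] have "Cauchy (\<lambda>n. F (r n) q)" by (auto simp: LIMSEQ_imp_Cauchy)
      then obtain N where N: "\<And>m n. m \<ge> N \<Longrightarrow> n \<ge> N \<Longrightarrow> dist (F (r m) q) (F (r n) q) < e/3"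
        using metric_CauchyD[of "\<lambda>n. F (r n) q" "e/3"] e by auto
      have "dist (F (r m) p) (F (r n) p) < e" if "m \<ge> N" "n \<ge> N" for m n
        using N[OF that] F1[of "r m" p q] F1[of "r n" p q] q(2) unfolding dist_real_def by linarith
      then show "\<exists>N. \<forall>m\<ge>N. \<forall>n\<ge>N. dist (F (r m) p) (F (r n) p) < e" by blast
    qed
    then show ?thesis by (rule Cauchy_convergent)
  qed
  define Gl where "Gl = {p \<in> P. (\<lambda>n. F (r n) p) \<longlonglongrightarrow> 0}"
  have Gl_cl: "closed Gl"
    unfolding closed_sequential_limits
  proof (intro allI impI, elim conjE)
    fix x p assume x: "\<forall>n. x n \<in> Gl" "x \<longlonglongrightarrow> p"
    then have "p \<in> P" using closed_sequentially[OF compact_imp_closed[OF P], of x p] by (auto simp: Gl_def)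
    from conv[OF this] obtain l where l: "(\<lambda>n. F (r n) p) \<longlonglongrightarrow> l" by (auto simp: convergent_def)
    have "l \<le> 0 + dist p (x k)" for k
    proof (rule LIMSEQ_le)
      show "(\<lambda>n. F (r n) p) \<longlonglongrightarrow> l" by fact
      show "(\<lambda>n. F (r n) (x k) + dist p (x k)) \<longlonglongrightarrow> 0 + dist p (x k)"
        using x(1) by (intro tendsto_intros) (auto simp: Gl_def)
      show "\<exists>N. \<forall>n\<ge>N. F (r n) p \<le> F (r n) (x k) + dist p (x k)"
      proof (intro exI allI impI)
        show "F (r n) p \<le> F (r n) (x k) + dist p (x k)" for n
          using F1[of "r n" p "x k"] by linarith
      qed
    qed
    moreover have "(\<lambda>k. 0 + dist p (x k)) \<longlonglongrightarrow> 0 + dist p p"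
      using x(2) by (intro tendsto_intros)
    ultimately have "l \<le> 0 + dist p p" by (intro LIMSEQ_le_const) auto
    moreover have "0 \<le> l" by (rule LIMSEQ_le_const[OF l]) (use F0 in blast)
    ultimately show "p \<in> Gl" using l \<open>p \<in> P\<close> by (simp add: Gl_def)
  qed
  have "Gl \<subseteq> P" by (auto simp: Gl_def)
  then have Gl: "compact Gl" using compact_Int_closed[OF P Gl_cl] by (simp add: Int_absorb1)
  have Gl_lip: "dist (snd p) (snd q) \<le> dist (fst p) (fst q)" if "p \<in> Gl" "q \<in> Gl" for p q
  proof (rule field_le_epsilon)
    fix e :: real assume e: "0 < e"
    have "\<forall>\<^sub>F n in sequentially. F (r n) p < e/4" "\<forall>\<^sub>F n in sequentially. F (r n) q < e/4"
      using that e by (auto simp: Gl_def intro!: order_tendstoD(2))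
    then have "\<forall>\<^sub>F n in sequentially. F (r n) p < e/4 \<and> F (r n) q < e/4" by eventually_elim simp
    then obtain n where n: "F (r n) p < e/4" "F (r n) q < e/4"
      using eventually_happens'[OF sequentially_bot] by blast
    have near: "\<exists>g\<in>G (r n). dist z g < e/4" if "F (r n) z < e/4" for z
      using that ne[of "r n"] unfolding F_def infdist_notempty[OF ne]
      by (subst (asm) cINF_less_iff) (auto intro: bdd_belowI[of _ 0])
    from near[OF n(1)] near[OF n(2)] obtain g g' where
      g: "g \<in> G (r n)" "dist p g < e/4" "g' \<in> G (r n)" "dist q g' < e/4" by blast
    have "dist (snd g) (snd g') \<le> dist (fst g) (fst g')" using lip g by blast
    moreover have "dist (snd p) (snd g) < e/4" "dist (fst p) (fst g) < e/4"
      "dist (snd q) (snd g') < e/4" "dist (fst q) (fst g') < e/4"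
      using g dist_snd_le[of p g] dist_fst_le[of p g] dist_snd_le[of q g'] dist_fst_le[of q g'] by linarith+
    moreover have "dist (snd p) (snd q) \<le> dist (snd p) (snd g) + dist (snd g) (snd g') + dist (snd q) (snd g')"
      using dist_triangle[of "snd p" "snd q" "snd g"] dist_triangle[of "snd g" "snd q" "snd g'"]
      by (simp add: dist_commute)
    moreover have "dist (fst g) (fst g') \<le> dist (fst p) (fst g) + dist (fst p) (fst q) + dist (fst q) (fst g')"
      using dist_triangle[of "fst g" "fst g'" "fst p"] dist_triangle[of "fst p" "fst g'" "fst q"]
      by (simp add: dist_commute)
    ultimately show "dist (snd p) (snd q) \<le> dist (fst p) (fst q) + e" by linarith
  qed
  define A where "A = fst ` Gl"
  define \<gamma> where "\<gamma> t = (SOME x. (t, x) \<in> Gl)" for t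
  have \<gamma>: "\<gamma> t = x" if "(t, x) \<in> Gl" for t x
  proof -
    have "(t, \<gamma> t) \<in> Gl" unfolding \<gamma>_def using that by (rule someI)
    then show ?thesis using Gl_lip[of "(t, \<gamma> t)" "(t, x)"] that by simp
  qed
  have \<gamma>A: "\<gamma> ` A = snd ` Gl" unfolding A_def using \<gamma> by force
  show thesis
  proof
    show "strict_mono r" by fact
    show "compact A" unfolding A_def by (intro compact_continuous_image Gl continuous_intros)
    show "1-lipschitz_on A \<gamma>"
      by (rule lipschitz_onI) (use \<gamma> Gl_lip in \<open>force simp: A_def\<close>)+
    show "\<gamma> ` A \<subseteq> K" using \<gamma>A \<open>Gl \<subseteq> P\<close> by (auto simp: P_def)
    show "\<forall>\<sigma> x l. strict_mono (\<sigma> :: nat \<Rightarrow> nat) \<longrightarrow> (\<forall>k. x k \<in> snd ` G (r (\<sigma> k))) \<longrightarrow> x \<longlonglongrightarrow> l \<longrightarrow> l \<in> \<gamma> ` A"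
    proof (intro allI impI)
      fix \<sigma> :: "nat \<Rightarrow> nat" and x l
      assume \<sigma>: "strict_mono \<sigma>" and x: "\<forall>k. x k \<in> snd ` G (r (\<sigma> k))" "x \<longlonglongrightarrow> l"
      have "\<exists>t. (t, x k) \<in> G (r (\<sigma> k))" for k
        using x(1)[rule_format, of k] by force
      then obtain t where t: "\<And>k. (t k, x k) \<in> G (r (\<sigma> k))" by metis
      have "\<And>k. (t k, x k) \<in> P" using t GP by blast
      then obtain p \<rho> where \<rho>: "strict_mono (\<rho> :: nat \<Rightarrow> nat)" "p \<in> P" "((\<lambda>k. (t k, x k)) \<circ> \<rho>) \<longlonglongrightarrow> p"
        using compact_imp_seq_compact[OF P] unfolding seq_compact_def by (metis (lifting))
      have "(\<lambda>k. snd (((\<lambda>k. (t k, x k)) \<circ> \<rho>) k)) \<longlonglongrightarrow> snd p" by (intro tendsto_snd \<rho>)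
      moreover have "(x \<circ> \<rho>) \<longlonglongrightarrow> l" using x(2) \<rho>(1) by (rule LIMSEQ_subseq_LIMSEQ)
      ultimately have l: "snd p = l" by (simp add: o_def LIMSEQ_unique)
      from conv[OF \<open>p \<in> P\<close>] obtain c where c: "(\<lambda>n. F (r n) p) \<longlonglongrightarrow> c" by (auto simp: convergent_def)
      have "strict_mono (\<sigma> \<circ> \<rho>)" using \<sigma> \<rho>(1) by (rule strict_mono_o)
      from LIMSEQ_subseq_LIMSEQ[OF c this] have c': "(\<lambda>k. F (r (\<sigma> (\<rho> k))) p) \<longlonglongrightarrow> c" by (simp add: o_def)
      have "(\<lambda>k. F (r (\<sigma> (\<rho> k))) p) \<longlonglongrightarrow> 0"
      proof (rule tendsto_sandwich[OF _ _ tendsto_const])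
        show "(\<lambda>k. dist p (((\<lambda>k. (t k, x k)) \<circ> \<rho>) k)) \<longlonglongrightarrow> 0"
          using tendsto_dist[OF tendsto_const \<rho>(3), of p] by simp
        show "\<forall>\<^sub>F k in sequentially. F (r (\<sigma> (\<rho> k))) p \<le> dist p (((\<lambda>k. (t k, x k)) \<circ> \<rho>) k)"
          using t by (intro always_eventually allI) (auto simp: F_def intro!: infdist_le)
      qed (simp add: F0)
      with c' have "c = 0" by (rule LIMSEQ_unique)
      with c \<open>p \<in> P\<close> have "p \<in> Gl" by (simp add: Gl_def)
      then show "l \<in> \<gamma> ` A" using l \<gamma>A by auto
    qed
  qed
qed

fun chain_sum :: "('a \<Rightarrow> 'a \<Rightarrow> real) \<Rightarrow> 'a list \<Rightarrow> real"
  where "chain_sum c (x # y # zs) = c x y + chain_sum c (y # zs)"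
  | "chain_sum c _ = 0"

lemma chain_sum_nonneg: "(\<And>x y. 0 \<le> c x y) \<Longrightarrow> 0 \<le> chain_sum c xs"
  by (induction c xs rule: chain_sum.induct) auto

lemma chain_sum_snoc: "xs \<noteq> [] \<Longrightarrow> chain_sum c (xs @ [y]) = chain_sum c xs + c (last xs) y"
  by (induction c xs rule: chain_sum.induct) auto

text \<open>The parametrisation of a chain by the length covered so far. The set \<open>G\<close> is the graph
of a partial function of the time, the form in which limits of chains can be taken.\<close>

lemma chain_graph:
  fixes xs :: "'a::metric_space list"
  assumes "xs \<noteq> []"
  shows "\<exists>G. snd ` G = set xs \<and> (0, hd xs) \<in> G \<and> fst ` G \<subseteq> {0..chain_sum dist xs} \<and>
    (\<forall>p\<in>G. \<forall>q\<in>G. dist (snd p) (snd q) \<le> dist (fst p) (fst q))"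
  using assms
proof (induction xs rule: induct_list012)
  case (2 x)
  then show ?case by (intro exI[of _ "{(0, x)}"]) auto
next
  case (3 x y zs)
  then obtain G where "snd ` G = set (y # zs)" "(0, hd (y # zs)) \<in> G" "fst ` G \<subseteq> {0..chain_sum dist (y # zs)}"
    "\<forall>p\<in>G. \<forall>q\<in>G. dist (snd p) (snd q) \<le> dist (fst p) (fst q)" by blast
  then have G: "snd ` G = set (y # zs)" "(0, y) \<in> G" "fst ` G \<subseteq> {0..chain_sum dist (y # zs)}"
    "\<And>p q. p \<in> G \<Longrightarrow> q \<in> G \<Longrightarrow> dist (snd p) (snd q) \<le> dist (fst p) (fst q)" by simp_all
  define f where "f p = (fst p + dist x y, snd p)" for p :: "real \<times> 'a"
  have pos: "0 \<le> fst p" if "p \<in> G" for p using G(3) that by auto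
  have x: "dist x (snd p) \<le> fst p + dist x y" if "p \<in> G" for p
    using G(4)[OF G(2) that] pos[OF that] dist_triangle[of x "snd p" y] by (simp add: dist_real_def)
  let ?G = "insert (0, x) (f ` G)"
  have "snd ` f ` G = snd ` G" by (auto simp: f_def image_image)
  then have "snd ` ?G = set (x # y # zs)" using G(1) by simp
  moreover have "fst ` ?G \<subseteq> {0..chain_sum dist (x # y # zs)}"
    using G(3) chain_sum_nonneg[of dist "y # zs"] by (auto simp: f_def)
  moreover have "\<forall>p\<in>?G. \<forall>q\<in>?G. dist (snd p) (snd q) \<le> dist (fst p) (fst q)"
    using x G(4) pos by (force simp: f_def dist_real_def dist_commute)
  ultimately show ?case by (intro exI[of _ ?G]) auto
qed simp

text \<open>Discrete intermediate values: a value between the two end values is passed by an upward step. The values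
passed by a short step lie within \<open>L * \<delta>\<close> of the value at its starting point, and those passed by
the long steps form the set \<open>J\<close>.\<close>

lemma chain_values_cover:
  fixes h :: "'a::metric_space \<Rightarrow> real"
  assumes "xs \<noteq> []" "\<And>x y. x \<in> set xs \<Longrightarrow> y \<in> set xs \<Longrightarrow> \<bar>h x - h y\<bar> \<le> L * dist x y" "0 \<le> L"
  shows "\<exists>J\<in>sets lborel. emeasure lborel J \<le> ennreal (chain_sum (\<lambda>x y. if dist x y \<le> \<delta> then 0 else max 0 (h y - h x)) xs) \<and>
     {h (hd xs)..h (last xs)} \<subseteq> (\<Union>x\<in>set xs. {h x - L * \<delta>..h x + L * \<delta>}) \<union> J"
  using assms
proof (induction xs rule: induct_list012)
  case (2 x)
  show ?case
    by (intro bexI[of _ "{h x}"]) auto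
next
  case (3 x y zs)
  let ?c = "\<lambda>x y. if dist x y \<le> \<delta> then 0 else max 0 (h y - h x)"
  from 3 obtain J where J: "J \<in> sets lborel" "emeasure lborel J \<le> ennreal (chain_sum ?c (y # zs))"
    "{h y..h (last (y # zs))} \<subseteq> (\<Union>x\<in>set (y # zs). {h x - L * \<delta>..h x + L * \<delta>}) \<union> J" by auto
  have split: "{h (hd (x # y # zs))..h (last (x # y # zs))} \<subseteq> {h x..h y} \<union> {h y..h (last (y # zs))}"
    by (auto split: if_splits)
  show ?case
  proof (cases "dist x y \<le> \<delta>")
    case True
    have "h y - h x \<le> L * dist x y" using 3(4)[of x y] by auto
    also have "\<dots> \<le> L * \<delta>" using True \<open>0 \<le> L\<close> by (rule mult_left_mono)
    finally have "{h x..h y} \<subseteq> {h x - L * \<delta>..h x + L * \<delta>}"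
      using True \<open>0 \<le> L\<close> by auto
    then have "{h (hd (x # y # zs))..h (last (x # y # zs))}
      \<subseteq> {h x - L * \<delta>..h x + L * \<delta>} \<union> ((\<Union>x\<in>set (y # zs). {h x - L * \<delta>..h x + L * \<delta>}) \<union> J)"
      using split J(3) by blast
    then show ?thesis using J(1,2) True by (intro bexI[of _ J]) (simp_all add: Un_assoc)
  next
    case False
    have "emeasure lborel ({h x..h y} \<union> J) \<le> emeasure lborel {h x..h y} + emeasure lborel J"
      using J(1) by (intro emeasure_subadditive) auto
    also have "\<dots> \<le> ennreal (max 0 (h y - h x)) + ennreal (chain_sum ?c (y # zs))"
      using J(2) by (intro add_mono) (auto simp: emeasure_lborel_Icc_eq max_def intro: ennreal_leI)
    also have "\<dots> = ennreal (chain_sum ?c (x # y # zs))"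
      using False by (simp add: chain_sum_nonneg ennreal_plus)
    finally have "emeasure lborel ({h x..h y} \<union> J) \<le> ennreal (chain_sum ?c (x # y # zs))" .
    moreover have "{h (hd (x # y # zs))..h (last (x # y # zs))}
      \<subseteq> (\<Union>x\<in>set (x # y # zs). {h x - L * \<delta>..h x + L * \<delta>}) \<union> ({h x..h y} \<union> J)"
      using split J(3) by (simp only: list.set UN_insert) blast
    ultimately show ?thesis using J(1) by (intro bexI[of _ "{h x..h y} \<union> J"] conjI) auto
  qed
qed simp

text \<open>A cover of \<open>E\<close> by sets of total diameter \<open>e\<close> gives a cover of \<open>h ` E\<close> by intervals of total length
\<open>2 * L * e\<close>.\<close>

lemma lipschitz_image_hausdorff_null:
  fixes E :: "'a::metric_space set" and h :: "'a \<Rightarrow> real"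
  assumes E: "hausdorff dist 1 E = 0" "h ` E \<in> sets lborel"
    and h: "\<And>x y. x \<in> E \<Longrightarrow> y \<in> E \<Longrightarrow> \<bar>h x - h y\<bar> \<le> L * dist x y" and L: "0 \<le> L"
  shows "emeasure lborel (h ` E) = 0"
proof -
  have "emeasure lborel (h ` E) \<le> 0 + ennreal (2 * L * e)" if e: "0 < e" for e
  proof -
    have "hausdorff_pre dist 1 1 E < ennreal e"
      using hausdorff_pre_le_hausdorff[of 1 dist 1 E] E e by simp
    then obtain C where C: "hcover dist 1 E C" "(\<Sum>i. hweight dist 1 (C i)) < ennreal e"
      by (rule hausdorff_pre_less)
    define D where "D i = enn2real (ediam dist (C i))" for i
    define p where "p i = (SOME x. x \<in> C i \<inter> E)" for i
    define I where "I i = {h (p i) - L * D i..h (p i) + L * D i}" for i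
    have "h ` E \<subseteq> (\<Union>i. I i)"
    proof
      fix v assume "v \<in> h ` E"
      then obtain x where x: "x \<in> E" "v = h x" by blast
      then obtain i where i: "x \<in> C i" using C(1) by (auto simp: hcover_def)
      then have p: "p i \<in> C i \<inter> E" unfolding p_def using x by (metis IntI someI)
      have "dist (p i) x \<le> D i" unfolding D_def
        by (rule dist_le_ediam[of _ _ 1]) (use C(1) i p in \<open>auto simp: hcover_def\<close>)
      then have "L * dist (p i) x \<le> L * D i" using L by (rule mult_left_mono)
      moreover have "\<bar>h (p i) - h x\<bar> \<le> L * dist (p i) x" using h p x by blast
      ultimately have "\<bar>h (p i) - h x\<bar> \<le> L * D i" by linarith
      then show "v \<in> (\<Union>i. I i)" unfolding x(2) I_def by (intro UN_I[of i]) auto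
    qed
    then have "emeasure lborel (h ` E) \<le> emeasure lborel (\<Union>i. I i)"
      by (rule emeasure_mono) (auto simp: I_def)
    also have "\<dots> \<le> (\<Sum>i. emeasure lborel (I i))"
      by (rule emeasure_subadditive_countably) (auto simp: I_def)
    also have "\<dots> = (\<Sum>i. ennreal (2 * L) * hweight dist 1 (C i))"
      using L by (intro suminf_cong) (auto simp: I_def D_def hweight_def simp flip: ennreal_mult)
    also have "\<dots> = ennreal (2 * L) * (\<Sum>i. hweight dist 1 (C i))" by simp
    also have "\<dots> \<le> ennreal (2 * L) * ennreal e" using C(2) by (intro mult_left_mono) auto
    also have "\<dots> = ennreal (2 * L * e)" using L e by (simp flip: ennreal_mult)
    finally show ?thesis by simp
  qed
  note * = this
  have "emeasure lborel (h ` E) \<le> 0"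
  proof (rule ennreal_le_epsilon)
    fix e :: real assume e: "0 < e"
    have "emeasure lborel (h ` E) \<le> 0 + ennreal (2 * L * (e / (2 * L + 1)))" using e L by (intro *) auto
    also have "\<dots> \<le> 0 + ennreal e" using e L by (intro add_left_mono ennreal_leI) (auto simp: field_simps)
    finally show "emeasure lborel (h ` E) \<le> 0 + ennreal e" .
  qed
  then show ?thesis by simp
qed

text \<open>The constant \<open>1\<close> is no restriction, since a rescaling of the domain turns any Lipschitz map into a
\<open>1\<close>-Lipschitz one; it is the natural constant for limits of chains parametrised by length.\<close>

definition curve_null :: "'a::metric_space set \<Rightarrow> bool"
  where "curve_null K \<longleftrightarrow> (\<forall>(A :: real set) \<gamma>. compact A \<longrightarrow> 1-lipschitz_on A \<gamma> \<longrightarrow> \<gamma> ` A \<subseteq> K \<longrightarrow> hausdorff dist 1 (\<gamma> ` A) = 0)"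

text \<open>No chain in \<open>K\<close> can gain height \<open>h\<close> by short steps alone: on the right, short steps are charged only their
length times \<open>\<eta>\<close>. The term \<open>\<eta> * chain_sum dist xs\<close> bounds the length of a chain that violates the inequality,
because \<open>h\<close> is bounded; this gives the compactness behind the passage to a limit curve.\<close>

lemma fine_chain_bound:
  fixes K :: "'a::metric_space set" and h :: "'a \<Rightarrow> real"
  assumes K: "compact K" "curve_null K"
    and h: "\<And>x y. x \<in> K \<Longrightarrow> y \<in> K \<Longrightarrow> \<bar>h x - h y\<bar> \<le> L * dist x y" "\<And>x. x \<in> K \<Longrightarrow> \<bar>h x\<bar> \<le> M"
    and "0 \<le> L" "0 < \<eta>" "0 < \<zeta>"
  shows "\<exists>\<delta>>0. \<forall>xs. xs \<noteq> [] \<longrightarrow> set xs \<subseteq> K \<longrightarrow> h (last xs) - h (hd xs)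
    \<le> chain_sum (\<lambda>x y. if dist x y \<le> \<delta> then 0 else max 0 (h y - h x)) xs + \<eta> * chain_sum dist xs + \<zeta>"
proof (rule ccontr)
  assume contra: "\<not> ?thesis"
  define c where "c \<delta> = (\<lambda>x y. if dist x y \<le> \<delta> then 0 else max 0 (h y - h x))" for \<delta> :: real
  define \<delta> where "\<delta> n = 1 / real (Suc n)" for n
  have "\<exists>xs. xs \<noteq> [] \<and> set xs \<subseteq> K \<and> h (last xs) - h (hd xs) > chain_sum (c (\<delta> n)) xs + \<eta> * chain_sum dist xs + \<zeta>" for n
  proof -
    have "0 < \<delta> n" by (simp add: \<delta>_def)
    then show ?thesis using contra by (auto simp: c_def not_le)
  qed
  then obtain xs where xs: "\<And>n. xs n \<noteq> []" "\<And>n. set (xs n) \<subseteq> K"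
    "\<And>n. h (last (xs n)) - h (hd (xs n)) > chain_sum (c (\<delta> n)) (xs n) + \<eta> * chain_sum dist (xs n) + \<zeta>" by metis
  have c0: "0 \<le> chain_sum (c \<delta>) ys" for \<delta> ys by (rule chain_sum_nonneg) (simp add: c_def)
  have len: "chain_sum dist (xs n) \<le> 2 * M / \<eta>" for n
  proof -
    have "last (xs n) \<in> K" "hd (xs n) \<in> K" using xs(1,2)[of n] by auto
    from h(2)[OF this(1)] h(2)[OF this(2)] have "\<eta> * chain_sum dist (xs n) \<le> 2 * M"
      using xs(3)[of n] c0[of "\<delta> n" "xs n"] \<open>0 < \<zeta>\<close> by linarith
    then show ?thesis using \<open>0 < \<eta>\<close> by (simp add: field_simps)
  qed
  obtain G where G: "\<And>n. snd ` G n = set (xs n)" "\<And>n. fst ` G n \<subseteq> {0..chain_sum dist (xs n)}"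
    "\<And>n p q. p \<in> G n \<Longrightarrow> q \<in> G n \<Longrightarrow> dist (snd p) (snd q) \<le> dist (fst p) (fst q)"
    using chain_graph[OF xs(1)] by metis
  have Gne: "G n \<noteq> {}" for n using G(1)[of n] xs(1)[of n] by auto
  have GP: "G n \<subseteq> {0..2 * M / \<eta>} \<times> K" for n
  proof
    fix p assume "p \<in> G n"
    then have "fst p \<in> {0..chain_sum dist (xs n)}" "snd p \<in> set (xs n)" using G(1,2) by blast+
    then show "p \<in> {0..2 * M / \<eta>} \<times> K" using len[of n] xs(2)[of n] by (auto simp: mem_Times_iff)
  qed
  obtain r and A :: "real set" and \<gamma> where r: "strict_mono (r :: nat \<Rightarrow> nat)" "compact A" "1-lipschitz_on A \<gamma>" "\<gamma> ` A \<subseteq> K"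
    "\<forall>\<sigma> x l. strict_mono (\<sigma> :: nat \<Rightarrow> nat) \<longrightarrow> (\<forall>k. x k \<in> snd ` G (r (\<sigma> k))) \<longrightarrow> x \<longlonglongrightarrow> l \<longrightarrow> l \<in> \<gamma> ` A"
    by (rule lipschitz_graph_limit[of K G "2 * M / \<eta>", OF K(1) Gne GP G(3)])
  define E where "E = \<gamma> ` A"
  have hcont: "continuous_on K h"
    by (rule lipschitz_on_continuous_on[of L]) (use h \<open>0 \<le> L\<close> in \<open>auto simp: lipschitz_on_def dist_real_def\<close>)
  have "compact E" unfolding E_def using r by (intro compact_continuous_image lipschitz_on_continuous_on)
  then have hE: "h ` E \<in> sets lborel"
    using r(4) hcont by (auto simp: E_def intro!: borel_compact compact_continuous_image elim: continuous_on_subset)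
  have null: "emeasure lborel (h ` E) = 0"
  proof (rule lipschitz_image_hausdorff_null[OF _ hE _ \<open>0 \<le> L\<close>])
    show "hausdorff dist 1 E = 0"
      using K(2) r(2-4) by (auto simp: curve_null_def E_def)
    show "\<bar>h x - h y\<bar> \<le> L * dist x y" if "x \<in> E" "y \<in> E" for x y
      using that r(4) h(1)[of x y] unfolding E_def by blast
  qed
  define W where "W n = (\<Union>x\<in>set (xs (r n)). {h x - L * \<delta> (r n)..h x + L * \<delta> (r n)})" for n
  have WM: "W n \<in> sets lborel" for n unfolding W_def by (intro sets.finite_UN) auto
  \<comment> \<open>The chain climbs by more than the cost of its long steps plus \<open>\<zeta>\<close>, so the values
    near values at points of the chain have measure at least \<open>\<zeta>\<close>.\<close>
  have W\<zeta>: "ennreal \<zeta> \<le> emeasure lborel (W n)" for n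
  proof -
    define y where "y = xs (r n)"
    define d where "d = \<delta> (r n)"
    have "y \<noteq> []" "\<And>a b. a \<in> set y \<Longrightarrow> b \<in> set y \<Longrightarrow> \<bar>h a - h b\<bar> \<le> L * dist a b"
      using xs(1,2)[of "r n"] h(1) by (auto simp: y_def)
    from chain_values_cover[OF this \<open>0 \<le> L\<close>, of d]
    obtain J where J: "J \<in> sets lborel" "emeasure lborel J \<le> ennreal (chain_sum (c d) y)"
      "{h (hd y)..h (last y)} \<subseteq> W n \<union> J" unfolding c_def W_def y_def d_def by blast
    have gt: "h (last y) - h (hd y) > chain_sum (c d) y + \<zeta>"
      using xs(3)[of "r n"] chain_sum_nonneg[of dist y] \<open>0 < \<eta>\<close>
      unfolding y_def d_def by (smt (verit) mult_nonneg_nonneg zero_le_dist)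
    have "ennreal (chain_sum (c d) y + \<zeta>) \<le> ennreal (h (last y) - h (hd y))"
      using gt by (intro ennreal_leI) simp
    also have "\<dots> = emeasure lborel {h (hd y)..h (last y)}"
      using gt c0[of d y] \<open>0 < \<zeta>\<close> by simp
    also have "\<dots> \<le> emeasure lborel (W n \<union> J)" using J WM by (intro emeasure_mono) auto
    also have "\<dots> \<le> emeasure lborel (W n) + emeasure lborel J" using J WM by (intro emeasure_subadditive)
    also have "\<dots> \<le> emeasure lborel (W n) + ennreal (chain_sum (c d) y)" by (intro add_left_mono J)
    finally have "ennreal \<zeta> + ennreal (chain_sum (c d) y) \<le> emeasure lborel (W n) + ennreal (chain_sum (c d) y)"
      using c0[of d y] \<open>0 < \<zeta>\<close> by (simp add: ennreal_plus add.commute)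
    then show ?thesis by (simp add: add.commute[of _ "ennreal (chain_sum _ _)"] ennreal_add_left_cancel_le)
  qed
  have WI: "W n \<subseteq> {- M - L..M + L}" for n
  proof
    fix v assume "v \<in> W n"
    then obtain x where "x \<in> set (xs (r n))" "h x - L * \<delta> (r n) \<le> v" "v \<le> h x + L * \<delta> (r n)"
      by (auto simp: W_def)
    then have x: "x \<in> K" "\<bar>h x - v\<bar> \<le> L * \<delta> (r n)" using xs(2) by auto
    have "L * \<delta> (r n) \<le> L * 1" using \<open>0 \<le> L\<close> by (intro mult_left_mono) (auto simp: \<delta>_def)
    then show "v \<in> {- M - L..M + L}" using x h(2)[OF x(1)] by auto
  qed
  \<comment> \<open>The values near values of infinitely many chains still have measure at least \<open>\<zeta>\<close>, and they
    are values of \<open>h\<close> on the limit curve.\<close>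
  define B where "B N = (\<Union>n\<in>{N..}. W n)" for N
  have BM: "B N \<in> sets lborel" for N unfolding B_def using WM by auto
  have "emeasure lborel (B N) \<le> emeasure lborel {- M - L..M + L}" for N
    using WI by (intro emeasure_mono) (auto simp: B_def)
  then have Bfin: "emeasure lborel (B N) \<noteq> \<infinity>" for N
    by (metis emeasure_lborel_Icc_eq ennreal_neq_top infinity_ennreal_def top.extremum_unique)
  have "(\<lambda>N. emeasure lborel (B N)) \<longlonglongrightarrow> emeasure lborel (\<Inter>N. B N)"
  proof (intro Lim_emeasure_decseq)
    show "decseq B" unfolding B_def decseq_def by (intro allI impI UN_mono) auto
  qed (use BM Bfin in auto)
  moreover have "ennreal \<zeta> \<le> emeasure lborel (B N)" for N
    by (rule order_trans[OF W\<zeta>[of N] emeasure_mono[OF _ BM]]) (auto simp: B_def)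
  ultimately have "ennreal \<zeta> \<le> emeasure lborel (\<Inter>N. B N)" by (intro LIMSEQ_le_const) auto
  also have "\<dots> \<le> emeasure lborel (h ` E)"
  proof (rule emeasure_mono[OF _ hE], rule subsetI)
    fix v assume v: "v \<in> (\<Inter>N. B N)"
    define S where "S = {n. v \<in> W n}"
    have "infinite S" unfolding infinite_nat_iff_unbounded_le S_def using v by (auto simp: B_def)
    define \<sigma> where "\<sigma> = enumerate S"
    have \<sigma>: "strict_mono \<sigma>" "\<And>k. v \<in> W (\<sigma> k)"
      using enumerate_in_set[OF \<open>infinite S\<close>] strict_mono_enumerate[OF \<open>infinite S\<close>]
      by (auto simp: \<sigma>_def S_def)
    have "\<exists>x. x \<in> set (xs (r (\<sigma> k))) \<and> \<bar>h x - v\<bar> \<le> L * \<delta> (r (\<sigma> k))" for k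
      using \<sigma>(2)[of k] by (auto simp: W_def abs_le_iff algebra_simps)
    then obtain x where x: "\<And>k. x k \<in> set (xs (r (\<sigma> k)))" "\<And>k. \<bar>h (x k) - v\<bar> \<le> L * \<delta> (r (\<sigma> k))" by metis
    have xK: "x k \<in> K" for k using x(1) xs(2) by blast
    then obtain l \<rho> where \<rho>: "strict_mono (\<rho> :: nat \<Rightarrow> nat)" "l \<in> K" "(x \<circ> \<rho>) \<longlonglongrightarrow> l"
      using compact_imp_seq_compact[OF K(1)] unfolding seq_compact_def by metis
    have mono: "strict_mono (\<sigma> \<circ> \<rho>)" using \<sigma>(1) \<rho>(1) by (rule strict_mono_o)
    have "l \<in> E" unfolding E_def
      by (rule r(5)[rule_format, OF mono _ \<rho>(3)]) (use x(1) G(1) in simp)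
    have 1: "(\<lambda>k. h ((x \<circ> \<rho>) k)) \<longlonglongrightarrow> h l"
      using continuous_on_tendsto_compose[OF hcont \<rho>(3,2)] xK by simp
    have "(\<lambda>k. \<delta> k) \<longlonglongrightarrow> 0" unfolding \<delta>_def using LIMSEQ_inverse_real_of_nat by (simp add: inverse_eq_divide)
    from LIMSEQ_subseq_LIMSEQ[OF this strict_mono_o[OF r(1) mono]]
    have "(\<lambda>k. L * \<delta> (r (\<sigma> (\<rho> k)))) \<longlonglongrightarrow> L * 0" by (intro tendsto_intros) (simp add: o_def)
    then have 0: "(\<lambda>k. L * \<delta> (r (\<sigma> (\<rho> k)))) \<longlonglongrightarrow> 0" by simp
    have "(\<lambda>k. h ((x \<circ> \<rho>) k) - v) \<longlonglongrightarrow> 0"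
    proof (rule Lim_null_comparison[OF _ 0])
      show "\<forall>\<^sub>F k in sequentially. norm (h ((x \<circ> \<rho>) k) - v) \<le> L * \<delta> (r (\<sigma> (\<rho> k)))"
        using x(2) by simp
    qed
    then have "(\<lambda>k. h ((x \<circ> \<rho>) k)) \<longlonglongrightarrow> v" by (rule LIM_zero_cancel)
    with 1 have "h l = v" by (rule LIMSEQ_unique)
    then show "v \<in> h ` E" using \<open>l \<in> E\<close> by blast
  qed
  finally show False using null \<open>0 < \<zeta>\<close> by simp
qed

section \<open>Flattening a function on a compact set\<close>

text \<open>The shortest path construction. The lower bound \<open>h x - \<zeta> \<le> g x\<close> is the bound on fine chains. The other
two properties say that \<open>g y \<le> g x + c x y\<close>, where \<open>c\<close> is the cost of a step: a chain ending in \<open>x\<close> is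
prolonged to \<open>y\<close> if \<open>x\<close> lies in \<open>K\<close>. If not, its last point \<open>x\<close> is replaced by \<open>y\<close>, which is no more
expensive because a step through a point outside \<open>K\<close> is charged the full increase of \<open>h\<close>.\<close>

lemma scalar_flattening:
  fixes K :: "'a::metric_space set" and h :: "'a \<Rightarrow> real"
  assumes K: "compact K" "curve_null K"
    and h: "\<And>x y. \<bar>h x - h y\<bar> \<le> L * dist x y" "\<And>x. \<bar>h x\<bar> \<le> M"
    and "0 \<le> L" "0 < \<eta>" "0 < \<zeta>"
  shows "\<exists>\<delta>>0. \<exists>g. (\<forall>x. h x - \<zeta> \<le> g x \<and> g x \<le> h x) \<and>
    (\<forall>x y. \<bar>g x - g y\<bar> \<le> \<bar>h x - h y\<bar> + \<eta> * dist x y) \<and>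
    (\<forall>x\<in>K. \<forall>y\<in>K. dist x y \<le> \<delta> \<longrightarrow> \<bar>g x - g y\<bar> \<le> \<eta> * dist x y)"
proof -
  obtain \<delta> where \<delta>: "\<delta> > 0" "\<And>xs. xs \<noteq> [] \<Longrightarrow> set xs \<subseteq> K \<Longrightarrow> h (last xs) - h (hd xs)
    \<le> chain_sum (\<lambda>x y. if dist x y \<le> \<delta> then 0 else max 0 (h y - h x)) xs + \<eta> * chain_sum dist xs + \<zeta>"
    using fine_chain_bound[OF K, of h L M \<eta> \<zeta>] assms by auto
  define c where "c x y = (if x \<in> K \<and> y \<in> K \<and> dist x y \<le> \<delta> then 0 else max 0 (h y - h x)) + \<eta> * dist x y" for x y
  have c_eq: "chain_sum c xs = chain_sum (\<lambda>x y. if dist x y \<le> \<delta> then 0 else max 0 (h y - h x)) xs + \<eta> * chain_sum dist xs"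
    if "set xs \<subseteq> K" for xs
    using that by (induction xs rule: induct_list012) (auto simp: c_def algebra_simps)
  have outside: "h y - h x \<le> c x y" if "\<not> (x \<in> K \<and> y \<in> K)" for x y
  proof -
    have "0 \<le> \<eta> * dist x y" using \<open>0 < \<eta>\<close> by simp
    then show ?thesis using that by (auto simp: c_def max_def)
  qed
  define S where "S x = (\<lambda>ks. h (hd (ks @ [x])) + chain_sum c (ks @ [x])) ` {ks. set ks \<subseteq> K}" for x
  define g where "g x = Inf (S x)" for x
  have hS: "h x \<in> S x" for x
    unfolding S_def by (rule image_eqI[of _ _ "[]"]) auto
  have low: "h x - \<zeta> \<le> v" if v: "v \<in> S x" for x v
  proof -
    obtain ks where ks: "set ks \<subseteq> K" "v = h (hd (ks @ [x])) + chain_sum c (ks @ [x])"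
      using v by (auto simp: S_def)
    show ?thesis
    proof (cases "x \<in> K \<or> ks = []")
      case True
      then consider "ks = []" | "set (ks @ [x]) \<subseteq> K" using ks by auto
      then show ?thesis
      proof cases
        case 1
        then show ?thesis using ks \<open>0 < \<zeta>\<close> by simp
      next
        case 2
        then show ?thesis using \<delta>(2)[of "ks @ [x]"] c_eq[of "ks @ [x]"] ks by simp
      qed
    next
      case False
      have "h x - h (last ks) \<le> c (last ks) x"
        using False outside by blast
      moreover have "h (last ks) - h (hd ks) \<le> chain_sum c ks + \<zeta>"
        using \<delta>(2)[of ks] c_eq[of ks] ks False by simp
      ultimately show ?thesis using ks False by (simp add: chain_sum_snoc)
    qed
  qed
  have bdd: "bdd_below (S x)" for x by (rule bdd_belowI) (rule low)
  have g: "h x - \<zeta> \<le> g x" "g x \<le> h x" for x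
    unfolding g_def using hS low by (auto intro!: cInf_greatest cInf_lower bdd)
  have step: "g y \<le> g x + c x y" for x y
  proof -
    have "g y - c x y \<le> v" if v: "v \<in> S x" for v
    proof -
      obtain ks where ks: "set ks \<subseteq> K" "v = h (hd (ks @ [x])) + chain_sum c (ks @ [x])"
        using v by (auto simp: S_def)
      have "\<exists>w\<in>S y. w \<le> v + c x y"
      proof (cases "x \<in> K")
        case True
        have "h (hd ((ks @ [x]) @ [y])) + chain_sum c ((ks @ [x]) @ [y]) \<in> S y"
          unfolding S_def using True ks by (intro image_eqI[of _ _ "ks @ [x]"]) auto
        moreover have "hd ((ks @ [x]) @ [y]) = hd (ks @ [x])" by (cases ks) auto
        ultimately show ?thesis using ks chain_sum_snoc[of "ks @ [x]" c y]
          by (intro bexI) auto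
      next
        case x: False
        show ?thesis
        proof (cases "ks = []")
          case True
          have "h y \<le> v + c x y" using outside[of x y] x True ks by simp
          then show ?thesis using hS by blast
        next
          case False
          have "h (hd (ks @ [y])) + chain_sum c (ks @ [y]) \<in> S y"
            unfolding S_def using ks by (intro image_eqI[of _ _ ks]) auto
          moreover have "c (last ks) y \<le> c (last ks) x + c x y"
          proof -
            have "\<eta> * dist (last ks) y \<le> \<eta> * dist (last ks) x + \<eta> * dist x y"
              using \<open>0 < \<eta>\<close> dist_triangle[of "last ks" y x] by (simp flip: distrib_left)
            moreover have "c (last ks) y \<le> max 0 (h y - h (last ks)) + \<eta> * dist (last ks) y"
              by (simp add: c_def)
            moreover have "max 0 (h y - h (last ks)) \<le> max 0 (h x - h (last ks)) + max 0 (h y - h x)"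
              by linarith
            moreover have "c (last ks) x = max 0 (h x - h (last ks)) + \<eta> * dist (last ks) x"
              "c x y = max 0 (h y - h x) + \<eta> * dist x y"
              using x by (simp_all add: c_def)
            ultimately show ?thesis by linarith
          qed
          ultimately show ?thesis using ks False
            by (intro bexI[of _ "h (hd (ks @ [y])) + chain_sum c (ks @ [y])"]) (auto simp: chain_sum_snoc)
        qed
      qed
      then obtain w where "w \<in> S y" "w \<le> v + c x y" by blast
      moreover from this(1) have "g y \<le> w" unfolding g_def by (intro cInf_lower bdd)
      ultimately show ?thesis by linarith
    qed
    then have "g y - c x y \<le> g x" unfolding g_def[of x] using hS by (intro cInf_greatest) auto
    then show ?thesis by linarith
  qed
  have "\<bar>g x - g y\<bar> \<le> \<bar>h x - h y\<bar> + \<eta> * dist x y" for x y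
  proof -
    have "c x y \<le> \<bar>h x - h y\<bar> + \<eta> * dist x y" "c y x \<le> \<bar>h x - h y\<bar> + \<eta> * dist x y"
      by (auto simp: c_def dist_commute)
    then show ?thesis using step[of x y] step[of y x] by linarith
  qed
  moreover have "\<bar>g x - g y\<bar> \<le> \<eta> * dist x y" if "x \<in> K" "y \<in> K" "dist x y \<le> \<delta>" for x y
    using step[of x y] step[of y x] that by (simp add: c_def dist_commute abs_le_iff)
  ultimately show ?thesis using \<delta>(1) g by blast
qed

lemma lp_norm_mono:
  fixes x y :: "real ^ 'm"
  assumes "1 \<le> p" "\<And>i. \<bar>x $ i\<bar> \<le> \<bar>y $ i\<bar>"
  shows "lp_norm p x \<le> lp_norm p y"
proof (cases "p = \<infinity>")
  case True
  have "\<bar>x $ i\<bar> \<le> Max (range (\<lambda>i. \<bar>y $ i\<bar>))" for i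
    using assms(2)[of i] abs_le_Max_component[of y i] by linarith
  then show ?thesis using True by (simp add: lp_norm_def)
next
  case False
  then have "1 \<le> real_of_ereal p" using assms(1) by (cases p) auto
  then show ?thesis using assms False
    by (auto simp: lp_norm_def intro!: powr_mono2 sum_mono sum_nonneg)
qed

lemma lp_norm_scaleR:
  fixes x :: "real ^ 'm"
  assumes "1 \<le> p"
  shows "lp_norm p (a *\<^sub>R x) = \<bar>a\<bar> * lp_norm p x"
proof (cases "p = \<infinity>")
  case True
  have "Max (range (\<lambda>i. \<bar>a\<bar> * \<bar>x $ i\<bar>)) = \<bar>a\<bar> * Max (range (\<lambda>i. \<bar>x $ i\<bar>))"
    using mono_Max_commute[of "\<lambda>t. \<bar>a\<bar> * t" "range (\<lambda>i. \<bar>x $ i\<bar>)"]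
    by (simp add: mono_def mult_left_mono image_image)
  then show ?thesis using True by (simp add: lp_norm_def abs_mult)
next
  case False
  then have q: "1 \<le> real_of_ereal p" using assms(1) by (cases p) auto
  have "(\<Sum>i\<in>UNIV. \<bar>a * x $ i\<bar> powr real_of_ereal p)
    = \<bar>a\<bar> powr real_of_ereal p * (\<Sum>i\<in>UNIV. \<bar>x $ i\<bar> powr real_of_ereal p)"
    by (simp add: abs_mult powr_mult sum_distrib_left)
  then show ?thesis using False q
    by (simp add: lp_norm_def powr_mult sum_nonneg powr_powr)
qed

lemma component_le_lp_norm:
  fixes x :: "real ^ 'm"
  assumes "1 \<le> p"
  shows "\<bar>x $ i\<bar> \<le> lp_norm p x"
proof (cases "p = \<infinity>")
  case True
  then show ?thesis using abs_le_Max_component[of x i] by (simp add: lp_norm_def)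
next
  case False
  then have q: "1 \<le> real_of_ereal p" using assms(1) by (cases p) auto
  have "\<bar>x $ i\<bar> = (\<bar>x $ i\<bar> powr real_of_ereal p) powr (1 / real_of_ereal p)"
    using q by (simp add: powr_powr)
  also have "\<dots> \<le> lp_norm p x"
    using q False by (auto simp: lp_norm_def intro!: powr_mono2 member_le_sum sum_nonneg)
  finally show ?thesis .
qed

text \<open>This is where the norm of the target matters: its monotonicity in the absolute values of the coordinates
allows each coordinate to be perturbed on its own.\<close>

lemma lp_norm_le_add_const:
  fixes x y :: "real ^ 'm"
  assumes "1 \<le> p" "\<And>i. \<bar>x $ i\<bar> \<le> \<bar>y $ i\<bar> + t" "0 \<le> t"
  shows "lp_norm p x \<le> lp_norm p y + t * lp_norm p (\<chi> i::'m. 1)"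
proof -
  have "lp_norm p x \<le> lp_norm p ((\<chi> i. \<bar>y $ i\<bar>) + t *\<^sub>R (\<chi> i. 1))"
    using assms by (intro lp_norm_mono) auto
  also have "\<dots> \<le> lp_norm p (\<chi> i. \<bar>y $ i\<bar>) + lp_norm p (t *\<^sub>R (\<chi> i. 1) :: real ^ 'm)"
    by (rule lp_norm_triangle) fact
  also have "lp_norm p (\<chi> i. \<bar>y $ i\<bar>) \<le> lp_norm p y" using assms(1) by (intro lp_norm_mono) auto
  also have "lp_norm p (t *\<^sub>R (\<chi> i. 1) :: real ^ 'm) = t * lp_norm p (\<chi> i::'m. 1)"
    using assms by (simp add: lp_norm_scaleR)
  finally show ?thesis by simp
qed

text \<open>Flattening the coordinates separately raises the Lipschitz constant to at most \<open>L + \<eta> * C\<close>, where \<open>C\<close> is the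
norm of the all-ones vector. Multiplication by \<open>a = L / (L + \<eta> * C)\<close> repairs this and moves a bounded function
only slightly. If \<open>L = 0\<close>, this factor vanishes, but then \<open>f\<close> is constant and needs no change.\<close>

lemma vector_flattening:
  fixes K :: "'a::metric_space set" and f :: "'a \<Rightarrow> real ^ 'm"
  assumes K: "compact K" "curve_null K" and p: "1 \<le> p"
    and f: "\<And>x y. lp_norm p (f x - f y) \<le> L * dist x y" "\<And>x. lp_norm p (f x) \<le> B"
    and L: "0 \<le> L" and \<theta>: "0 < \<theta>" and e: "0 < e"
  shows "\<exists>\<delta>>0. \<exists>g. (\<forall>x y. lp_norm p (g x - g y) \<le> L * dist x y) \<and>
    (\<forall>x. lp_norm p (f x - g x) \<le> e) \<and>
    (\<forall>x\<in>K. \<forall>y\<in>K. dist x y \<le> \<delta> \<longrightarrow> lp_norm p (g x - g y) \<le> \<theta> * dist x y)"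
proof (cases "L = 0")
  case True
  have "lp_norm p (f x - f y) \<le> \<theta> * dist x y" for x y
    by (rule order_trans[OF f(1)]) (use True \<theta> in simp)
  then show ?thesis using True f(1) e lp_norm_eq_0_iff[OF p, of "0 :: real ^ 'm"]
    by (intro exI[of _ 1] conjI exI[of _ f]) auto
next
  case False
  then have L: "0 < L" using L by simp
  define C where "C = lp_norm p (\<chi> i::'m. 1)"
  have C: "0 \<le> C" by (simp add: C_def lp_norm_nonneg)
  have B: "0 \<le> B" using f(2)[of undefined] lp_norm_nonneg[of p "f undefined"] by linarith
  \<comment> \<open>Half of \<open>e\<close> is spent on flattening and half on rescaling; \<open>C + 1\<close> replaces \<open>C\<close> only to have a
    visibly positive denominator.\<close>
  define \<zeta> where "\<zeta> = e / (2 * (C + 1))"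
  define \<eta> where "\<eta> = min (\<theta> / (C + 1)) (L * e / (2 * (C + 1) * (B + e)))"
  have pos: "0 < \<zeta>" "0 < \<eta>" using C e \<theta> L B by (auto simp: \<zeta>_def \<eta>_def)
  have C\<zeta>: "\<zeta> * C \<le> e / 2" using C e by (simp add: \<zeta>_def field_simps)
  have "\<eta> * C \<le> \<eta> * (C + 1)" using pos by simp
  also have "\<dots> \<le> \<theta> / (C + 1) * (C + 1)" using C by (intro mult_right_mono) (auto simp: \<eta>_def)
  finally have C\<eta>: "\<eta> * C \<le> \<theta>" using C by simp
  have "\<eta> * C * (B + e) \<le> \<eta> * (C + 1) * (B + e)" using pos B e by (intro mult_right_mono) auto
  also have "\<dots> \<le> L * e / (2 * (C + 1) * (B + e)) * (C + 1) * (B + e)"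
    using C B e by (intro mult_right_mono) (auto simp: \<eta>_def)
  also have "\<dots> = L * e / 2"
  proof -
    have "t / (2 * u * v) * u * v = t / 2" if "u \<noteq> 0" "v \<noteq> 0" for t u v :: real
      using that by simp
    from this[of "C + 1" "B + e" "L * e"] show ?thesis using C B e by simp
  qed
  finally have C\<eta>B: "\<eta> * C * (B + e) \<le> L * e / 2" .
  have "\<exists>\<delta>>0. \<exists>g. (\<forall>x. f x $ i - \<zeta> \<le> g x \<and> g x \<le> f x $ i) \<and>
    (\<forall>x y. \<bar>g x - g y\<bar> \<le> \<bar>f x $ i - f y $ i\<bar> + \<eta> * dist x y) \<and>
    (\<forall>x\<in>K. \<forall>y\<in>K. dist x y \<le> \<delta> \<longrightarrow> \<bar>g x - g y\<bar> \<le> \<eta> * dist x y)" for i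
  proof (rule scalar_flattening[OF K])
    show "\<bar>f x $ i - f y $ i\<bar> \<le> L * dist x y" for x y
      using component_le_lp_norm[OF p, of "f x - f y" i] f(1)[of x y] by simp
    show "\<bar>f x $ i\<bar> \<le> B" for x
      using component_le_lp_norm[OF p, of "f x" i] f(2)[of x] by simp
  qed (use L pos in auto)
  then obtain \<delta> g where g: "\<And>i. 0 < \<delta> i" "\<And>i x. f x $ i - \<zeta> \<le> g i x \<and> g i x \<le> f x $ i"
    "\<And>i x y. \<bar>g i x - g i y\<bar> \<le> \<bar>f x $ i - f y $ i\<bar> + \<eta> * dist x y"
    "\<And>i x y. x \<in> K \<Longrightarrow> y \<in> K \<Longrightarrow> dist x y \<le> \<delta> i \<Longrightarrow> \<bar>g i x - g i y\<bar> \<le> \<eta> * dist x y"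
    by metis
  define G where "G x = (\<chi> i. g i x)" for x
  have G1: "lp_norm p (G x - G y) \<le> (L + \<eta> * C) * dist x y" for x y
  proof -
    have "lp_norm p (G x - G y) \<le> lp_norm p (f x - f y) + \<eta> * dist x y * C"
      unfolding C_def using g(3) pos by (intro lp_norm_le_add_const p) (auto simp: G_def)
    then show ?thesis using f(1)[of x y] by (simp add: algebra_simps)
  qed
  have G2: "lp_norm p (f x - G x) \<le> e / 2" for x
  proof -
    have "lp_norm p (f x - G x) \<le> lp_norm p (0 :: real ^ 'm) + \<zeta> * C"
      unfolding C_def using g(2) pos
      by (intro lp_norm_le_add_const p) (auto simp: G_def abs_le_iff algebra_simps)
    then show ?thesis using C\<zeta> lp_norm_eq_0_iff[OF p, of "0 :: real ^ 'm"] by simp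
  qed
  have G3: "lp_norm p (G x - G y) \<le> \<eta> * C * dist x y" if "x \<in> K" "y \<in> K" "\<And>i. dist x y \<le> \<delta> i" for x y
  proof -
    have "lp_norm p (G x - G y) \<le> lp_norm p (0 :: real ^ 'm) + \<eta> * dist x y * C"
      unfolding C_def using g(4) pos that by (intro lp_norm_le_add_const p) (auto simp: G_def)
    then show ?thesis using lp_norm_eq_0_iff[OF p, of "0 :: real ^ 'm"] by (simp add: ac_simps)
  qed
  define a where "a = L / (L + \<eta> * C)"
  have den: "0 < L + \<eta> * C" using L pos C by (simp add: add_pos_nonneg)
  have a: "0 \<le> a" "a \<le> 1" "a * (L + \<eta> * C) = L" using L den pos C by (auto simp: a_def field_simps)
  have a1: "(1 - a) * (B + e) \<le> e / 2"
  proof -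
    have "1 - a = \<eta> * C / (L + \<eta> * C)" using den by (simp add: a_def field_simps)
    also have "\<dots> \<le> \<eta> * C / L" using L pos C mult_pos_pos[OF den L] by (intro divide_left_mono) auto
    finally have "(1 - a) * (B + e) \<le> \<eta> * C / L * (B + e)" using B e by (intro mult_right_mono) auto
    also have "\<dots> \<le> e / 2" using C\<eta>B L by (simp add: field_simps)
    finally show ?thesis .
  qed
  have diff: "lp_norm p (a *\<^sub>R G x - a *\<^sub>R G y) = a * lp_norm p (G x - G y)" for x y
    using a lp_norm_scaleR[OF p, of a "G x - G y"] by (simp add: scaleR_diff_right)
  show ?thesis
  proof (intro exI conjI allI ballI impI)
    show "0 < Min (range \<delta>)" using g(1) by (subst Min_gr_iff) auto
    fix x y
    have "a * lp_norm p (G x - G y) \<le> a * ((L + \<eta> * C) * dist x y)" using a by (intro mult_left_mono G1)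
    then show "lp_norm p (a *\<^sub>R G x - a *\<^sub>R G y) \<le> L * dist x y" using a(3) by (simp add: diff flip: mult.assoc)
    have "lp_norm p (G x) \<le> lp_norm p (f x) + lp_norm p (f x - G x)"
      using lp_norm_triangle[OF p, of "f x" "G x - f x"] lp_norm_minus_commute[of p "f x" "G x"] by simp
    then have GB: "lp_norm p (G x) \<le> B + e" using f(2)[of x] G2[of x] e by linarith
    have "f x - a *\<^sub>R G x = (f x - G x) + (1 - a) *\<^sub>R G x" by (simp add: algebra_simps)
    then have "lp_norm p (f x - a *\<^sub>R G x) \<le> lp_norm p (f x - G x) + lp_norm p ((1 - a) *\<^sub>R G x)"
      using lp_norm_triangle[OF p] by metis
    also have "lp_norm p ((1 - a) *\<^sub>R G x) = (1 - a) * lp_norm p (G x)" using a by (simp add: lp_norm_scaleR[OF p])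
    also have "\<dots> \<le> (1 - a) * (B + e)" using a GB by (intro mult_left_mono) auto
    finally show "lp_norm p (f x - a *\<^sub>R G x) \<le> e" using a1 G2[of x] by linarith
  next
    fix x y assume *: "x \<in> K" "y \<in> K" "dist x y \<le> Min (range \<delta>)"
    have "dist x y \<le> \<delta> i" for i using * Min_le[of "range \<delta>" "\<delta> i"] by simp
    then have "lp_norm p (G x - G y) \<le> \<eta> * C * dist x y" using * by (intro G3) auto
    also have "\<dots> \<le> \<theta> * dist x y" using C\<eta> by (intro mult_right_mono) auto
    finally have "lp_norm p (G x - G y) \<le> \<theta> * dist x y" .
    then show "lp_norm p (a *\<^sub>R G x - a *\<^sub>R G y) \<le> \<theta> * dist x y"
      using mult_right_mono[OF a(2) lp_norm_nonneg[of p "G x - G y"]] by (simp add: diff)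
  qed
qed

section \<open>Hausdorff content of images under nearby functions\<close>

text \<open>At scales below \<open>\<delta>\<close>, the function \<open>g\<close> shrinks diameters by the factor \<open>\<theta>\<close>, hence weights by \<open>\<theta> powr s\<close>.
Passing to a finite subcover of an open cover makes the bound stable: finitely many diameters may all
grow by a common small \<open>\<rho>\<close>.\<close>

lemma hausdorff_pre_image_near_flat:
  fixes K :: "'a::metric_space set" and g :: "'a \<Rightarrow> 'b"
  assumes s: "0 < s" and K: "compact K" "hausdorff dist s K < \<infinity>"
    and flat: "0 < \<delta>" "\<And>x y. x \<in> K \<Longrightarrow> y \<in> K \<Longrightarrow> dist x y \<le> \<delta> \<Longrightarrow> d (g x) (g y) \<le> \<theta> * dist x y"
    and \<theta>: "0 < \<theta>" and \<nu>: "0 < \<nu>" "\<theta> powr s * (enn2real (hausdorff dist s K) + 1) < \<nu>"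
  shows "\<exists>\<rho>>0. \<forall>f :: 'a \<Rightarrow> 'b. (\<forall>x\<in>K. \<forall>y\<in>K. d (f x) (f y) \<le> d (g x) (g y) + \<rho>)
    \<longrightarrow> hausdorff_pre d s \<nu> (f ` K) \<le> ennreal \<nu>"
proof -
  define \<delta>1 where "\<delta>1 = min \<delta> (\<nu> / (2 * \<theta>))"
  have \<delta>1: "0 < \<delta>1" "\<delta>1 \<le> \<delta>" "\<theta> * \<delta>1 \<le> \<nu> / 2"
  proof -
    show "0 < \<delta>1" "\<delta>1 \<le> \<delta>" using flat \<theta> \<nu> by (auto simp: \<delta>1_def)
    have "\<theta> * \<delta>1 \<le> \<theta> * (\<nu> / (2 * \<theta>))" using \<theta> by (intro mult_left_mono) (auto simp: \<delta>1_def)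
    then show "\<theta> * \<delta>1 \<le> \<nu> / 2" using \<theta> by simp
  qed
  obtain C where C: "hcover dist \<delta>1 K C" "\<And>i. open (C i)"
    "(\<Sum>i. hweight dist s (C i)) \<le> hausdorff dist s K + ennreal 1"
    using hausdorff_open_cover[OF s K(2) \<delta>1(1), of 1] by auto
  define D where "D i = enn2real (ediam dist (C i))" for i
  have le: "ediam dist (C i) \<le> ennreal \<delta>1" for i using C(1) by (simp add: hcover_def)
  have D: "0 \<le> D i" "D i \<le> \<delta>1" for i
    using enn2real_le_of_le[OF le, of i] \<delta>1 by (auto simp: D_def)
  have dD: "dist x y \<le> D i" if "x \<in> C i" "y \<in> C i" for x y i
    unfolding D_def by (rule dist_le_ediam[OF le that])
  obtain I where I: "finite I" "K \<subseteq> (\<Union>i\<in>I. C i)"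
    using compactE_image[OF K(1), of UNIV C] C(1,2) by (auto simp: hcover_def)
  define m where "m = enn2real (hausdorff dist s K) + 1"
  have "(\<Sum>i\<in>I. D i powr s) \<le> m"
  proof -
    have "ennreal (\<Sum>i\<in>I. D i powr s) = (\<Sum>i\<in>I. hweight dist s (C i))"
      by (simp add: hweight_def D_def sum_ennreal)
    also have "\<dots> \<le> (\<Sum>i. hweight dist s (C i))" using I(1) by (intro sum_le_suminf) auto
    also note C(3)
    also have "hausdorff dist s K + ennreal 1 = ennreal m"
      using K(2) unfolding m_def by (subst ennreal_plus) auto
    finally show ?thesis by (subst (asm) ennreal_le_iff) (simp_all add: m_def)
  qed
  then have "\<theta> powr s * (\<Sum>i\<in>I. D i powr s) \<le> \<theta> powr s * m" by (intro mult_left_mono) auto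
  moreover have "(\<Sum>i\<in>I. (\<theta> * D i) powr s) = \<theta> powr s * (\<Sum>i\<in>I. D i powr s)"
    using \<theta> D by (simp add: powr_mult sum_distrib_left)
  ultimately have lt: "(\<Sum>i\<in>I. (\<theta> * D i + 0) powr s) < \<nu>" using \<nu>(2) by (simp add: m_def)
  have "((\<lambda>t. \<Sum>i\<in>I. (\<theta> * D i + t) powr s) \<longlongrightarrow> (\<Sum>i\<in>I. (\<theta> * D i + 0) powr s)) (at_right 0)"
    using s \<theta> D by (intro tendsto_sum tendsto_powr' tendsto_intros)
      (auto intro!: eventually_at_rightI[of 0 1] add_nonneg_nonneg mult_nonneg_nonneg)
  from order_tendstoD(2)[OF this lt]
  have "\<forall>\<^sub>F t in at_right 0. (\<Sum>i\<in>I. (\<theta> * D i + t) powr s) < \<nu>" .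
  moreover have "\<forall>\<^sub>F t in at_right 0. t \<le> \<nu> / 2"
    using \<nu>(1) by (intro eventually_at_rightI[of 0 "\<nu>/2"]) auto
  moreover have "\<forall>\<^sub>F t in at_right 0. (0::real) < t" by (rule eventually_at_right_less)
  ultimately have "\<forall>\<^sub>F t in at_right 0. (\<Sum>i\<in>I. (\<theta> * D i + t) powr s) < \<nu> \<and> t \<le> \<nu> / 2 \<and> 0 < t"
    by eventually_elim auto
  then obtain \<rho> where \<rho>: "(\<Sum>i\<in>I. (\<theta> * D i + \<rho>) powr s) < \<nu>" "\<rho> \<le> \<nu> / 2" "0 < \<rho>"
    using eventually_happens'[of "at_right (0::real)"] by force
  show ?thesis
  proof (intro exI[of _ \<rho>] conjI allI impI \<rho>(3))
    fix f :: "'a \<Rightarrow> 'b" assume f: "\<forall>x\<in>K. \<forall>y\<in>K. d (f x) (f y) \<le> d (g x) (g y) + \<rho>"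
    define V where "V i = (if i \<in> I then f ` (C i \<inter> K) else {})" for i
    have V: "ediam d (V i) \<le> ennreal (\<theta> * D i + \<rho>)" if iI: "i \<in> I" for i
    proof (rule ediam_leI)
      fix u v assume "u \<in> V i" "v \<in> V i"
      then obtain x y where xy: "x \<in> C i" "x \<in> K" "u = f x" "y \<in> C i" "y \<in> K" "v = f y"
        using iI by (auto simp: V_def)
      have "dist x y \<le> D i" using dD xy by blast
      then have "d (g x) (g y) \<le> \<theta> * dist x y" using flat(2) xy D(2)[of i] \<delta>1(2) by auto
      also have "\<dots> \<le> \<theta> * D i" using \<theta> \<open>dist x y \<le> D i\<close> by (intro mult_left_mono) auto
      finally show "d u v \<le> \<theta> * D i + \<rho>" using f xy by fastforce
    qed
    have pos: "0 \<le> \<theta> * D i + \<rho>" for i using \<theta> D(1)[of i] \<rho>(3) by (intro add_nonneg_nonneg) auto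
    have cov: "hcover d \<nu> (f ` K) V"
      unfolding hcover_def
    proof (intro conjI allI)
      show "f ` K \<subseteq> (\<Union>i. V i)"
      proof
        fix u assume "u \<in> f ` K"
        then obtain x i where "x \<in> K" "u = f x" "i \<in> I" "x \<in> C i" using I(2) by blast
        then have "u \<in> V i" by (auto simp: V_def)
        then show "u \<in> (\<Union>i. V i)" by blast
      qed
      fix i
      show "ediam d (V i) \<le> ennreal \<nu>"
      proof (cases "i \<in> I")
        case True
        have "\<theta> * D i \<le> \<theta> * \<delta>1" using \<theta> D by (intro mult_left_mono) auto
        then have "ennreal (\<theta> * D i + \<rho>) \<le> ennreal \<nu>" using \<delta>1(3) \<rho>(2) by (intro ennreal_leI) linarith
        then show ?thesis using V[OF True] order_trans by blast
      qed (simp add: V_def)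
    qed
    have "hausdorff_pre d s \<nu> (f ` K) \<le> (\<Sum>i. hweight d s (V i))" by (rule hausdorff_pre_le[OF cov])
    also have "\<dots> = (\<Sum>i\<in>I. hweight d s (V i))"
      using I(1) by (intro suminf_finite) (auto simp: V_def)
    also have "\<dots> \<le> (\<Sum>i\<in>I. ennreal ((\<theta> * D i + \<rho>) powr s))"
      unfolding hweight_def using s
      by (intro sum_mono ennreal_leI powr_mono2 enn2real_le_of_le V pos) auto
    also have "\<dots> = ennreal (\<Sum>i\<in>I. (\<theta> * D i + \<rho>) powr s)" by (simp add: sum_ennreal)
    also have "\<dots> \<le> ennreal \<nu>" using \<rho>(1) by (intro ennreal_leI) simp
    finally show "hausdorff_pre d s \<nu> (f ` K) \<le> ennreal \<nu>" .
  qed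
qed

lemma hausdorff_lipschitz_image_null:
  fixes A :: "'a set" and f :: "'a \<Rightarrow> 'b"
  assumes s: "0 < s" and A: "hausdorff d s A = 0"
    and f: "\<And>x y. d' (f x) (f y) \<le> L * d x y" and L: "0 \<le> L"
  shows "hausdorff d' s (f ` A) = 0"
proof -
  have "hausdorff d' s (f ` A) \<le> 0"
  proof (rule hausdorff_le_of_covers)
    fix \<delta> e :: real assume pos: "0 < \<delta>" "0 < e"
    define e' where "e' = e / (L powr s + 1)"
    have "0 < L powr s + 1" using powr_ge_zero[of L s] by linarith
    then have e': "0 < e'" "L powr s * e' \<le> e" using pos by (auto simp: e'_def field_simps)
    have "0 < \<delta> / (L + 1)" using pos L by simp
    then have "hausdorff_pre d s (\<delta> / (L + 1)) A \<le> 0" using hausdorff_pre_le_hausdorff[of "\<delta> / (L + 1)" d s A] A by simp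
    then have "hausdorff_pre d s (\<delta> / (L + 1)) A < ennreal e'" using e' by (simp add: le_less_trans)
    then obtain C where C: "hcover d (\<delta> / (L + 1)) A C" "(\<Sum>i. hweight d s (C i)) < ennreal e'"
      by (rule hausdorff_pre_less)
    have le: "ediam d (C i) \<le> ennreal (\<delta> / (L + 1))" for i using C(1) by (simp add: hcover_def)
    define D where "D i = enn2real (ediam d (C i))" for i
    have D: "0 \<le> D i" "D i \<le> \<delta> / (L + 1)" for i
      using enn2real_le_of_le[OF le, of i] \<open>0 < \<delta> / (L + 1)\<close> by (auto simp: D_def)
    have V: "ediam d' (f ` C i) \<le> ennreal (L * D i)" for i
    proof (rule ediam_leI)
      fix u v assume "u \<in> f ` C i" "v \<in> f ` C i"
      then obtain x y where xy: "x \<in> C i" "u = f x" "y \<in> C i" "v = f y" by blast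
      have "d x y \<le> D i" unfolding D_def by (rule dist_le_ediam[OF le]) (use xy in auto)
      then have "L * d x y \<le> L * D i" using L by (rule mult_left_mono)
      then show "d' u v \<le> L * D i" using f[of x y] xy by simp
    qed
    have "L * D i \<le> \<delta>" for i
    proof -
      have "L * D i \<le> (L + 1) * (\<delta> / (L + 1))" using D L by (intro mult_mono) auto
      then show ?thesis using L by simp
    qed
    then have "ediam d' (f ` C i) \<le> ennreal \<delta>" for i using V[of i] ennreal_leI order_trans by blast
    then have cov: "hcover d' \<delta> (f ` A) (\<lambda>i. f ` C i)"
      using C(1) image_mono[of A "\<Union>i. C i" f] by (simp add: hcover_def image_UN)
    have "(\<Sum>i. hweight d' s (f ` C i)) \<le> (\<Sum>i. ennreal (L powr s) * hweight d s (C i))"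
    proof (intro suminf_le allI)
      fix i
      have "enn2real (ediam d' (f ` C i)) powr s \<le> (L * D i) powr s"
        using s L D V by (intro powr_mono2 enn2real_le_of_le) auto
      also have "\<dots> = L powr s * D i powr s" using L D by (simp add: powr_mult)
      finally show "hweight d' s (f ` C i) \<le> ennreal (L powr s) * hweight d s (C i)"
        unfolding hweight_def D_def by (simp add: ennreal_leI flip: ennreal_mult)
    qed auto
    also have "\<dots> = ennreal (L powr s) * (\<Sum>i. hweight d s (C i))" by simp
    also have "\<dots> \<le> ennreal (L powr s) * ennreal e'" using C(2) by (intro mult_left_mono) auto
    also have "\<dots> = ennreal (L powr s * e')" using e' by (simp flip: ennreal_mult)
    also have "\<dots> \<le> 0 + ennreal e" using e' by (simp add: ennreal_leI)
    finally show "\<exists>C. hcover d' \<delta> (f ` A) C \<and> (\<Sum>i. hweight d' s (C i)) \<le> 0 + ennreal e"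
      using cov by blast
  qed
  then show ?thesis by simp
qed

section \<open>Curve-null sets\<close>

text \<open>On sets of diameter at most \<open>\<delta>1\<close>, the diameter is at most \<open>\<delta>1 powr (1 - s)\<close> times its power with exponent
\<open>s\<close>, and this factor tends to zero with \<open>\<delta>1\<close>.\<close>

lemma hausdorff_one_null_of_less:
  fixes K :: "'a::metric_space set"
  assumes s: "0 < s" "s < 1" and fin: "hausdorff dist s K < \<infinity>"
  shows "hausdorff dist 1 K = 0"
proof -
  define m where "m = enn2real (hausdorff dist s K) + 1"
  have m: "0 < m" by (simp add: m_def add_nonneg_pos)
  have "hausdorff dist 1 K \<le> 0"
  proof (rule hausdorff_le_of_covers)
    fix \<delta> e :: real assume pos: "0 < \<delta>" "0 < e"
    define \<delta>1 where "\<delta>1 = min \<delta> ((e / m) powr (1 / (1 - s)))"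
    have \<delta>1: "0 < \<delta>1" "\<delta>1 \<le> \<delta>" using pos m by (auto simp: \<delta>1_def)
    have "\<delta>1 powr (1 - s) \<le> ((e / m) powr (1 / (1 - s))) powr (1 - s)"
      using \<delta>1 s by (intro powr_mono2) (auto simp: \<delta>1_def)
    also have "\<dots> = e / m" using s pos m by (simp add: powr_powr)
    finally have \<delta>1e: "\<delta>1 powr (1 - s) * m \<le> e" using m by (simp add: field_simps)
    obtain C where C: "hcover dist \<delta>1 K C" "(\<Sum>i. hweight dist s (C i)) \<le> hausdorff dist s K + ennreal 1"
      using hausdorff_closed_cover[of s K \<delta>1 1] s fin \<delta>1 by auto
    have le: "ediam dist (C i) \<le> ennreal \<delta>1" for i using C(1) by (simp add: hcover_def)
    have "(\<Sum>i. hweight dist 1 (C i)) \<le> (\<Sum>i. ennreal (\<delta>1 powr (1 - s)) * hweight dist s (C i))"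
    proof (intro suminf_le allI)
      fix i
      define D where "D = enn2real (ediam dist (C i))"
      have D: "0 \<le> D" "D \<le> \<delta>1" using enn2real_le_of_le[OF le, of i] \<delta>1 by (auto simp: D_def)
      have "D powr 1 = D powr (1 - s) * D powr s" by (simp flip: powr_add)
      also have "\<dots> \<le> \<delta>1 powr (1 - s) * D powr s"
        using D s by (intro mult_right_mono powr_mono2) auto
      finally show "hweight dist 1 (C i) \<le> ennreal (\<delta>1 powr (1 - s)) * hweight dist s (C i)"
        unfolding hweight_def D_def by (simp add: ennreal_leI flip: ennreal_mult)
    qed auto
    also have "\<dots> = ennreal (\<delta>1 powr (1 - s)) * (\<Sum>i. hweight dist s (C i))" by simp
    also have "\<dots> \<le> ennreal (\<delta>1 powr (1 - s)) * ennreal m"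
    proof (rule mult_left_mono)
      have "hausdorff dist s K + ennreal 1 = ennreal m"
        using fin unfolding m_def by (subst ennreal_plus) auto
      then show "(\<Sum>i. hweight dist s (C i)) \<le> ennreal m" using C(2) by simp
    qed simp
    also have "\<dots> = ennreal (\<delta>1 powr (1 - s) * m)" using m by (simp flip: ennreal_mult)
    also have "\<dots> \<le> 0 + ennreal e" using \<delta>1e by (simp add: ennreal_leI)
    finally show "\<exists>C. hcover dist \<delta> K C \<and> (\<Sum>i. hweight dist 1 (C i)) \<le> 0 + ennreal e"
      using hcover_mono[OF C(1) _ \<delta>1(2), of K] C(1) unfolding hcover_def by blast
  qed
  then show ?thesis by simp
qed

lemma curve_null_of_unrectifiable:
  fixes S :: "'a::metric_space set"
  assumes S: "purely_one_unrectifiable S" and K: "K \<subseteq> S"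
  shows "curve_null K"
  unfolding curve_null_def
proof (intro allI impI)
  fix A :: "real set" and \<gamma> :: "real \<Rightarrow> 'a"
  assume A: "compact A" "1-lipschitz_on A \<gamma>" "\<gamma> ` A \<subseteq> K"
  have "compact (\<gamma> ` A)" using A by (intro compact_continuous_image lipschitz_on_continuous_on)
  then have "hausdorff_measurable 1 (\<gamma> ` A)" by (intro hausdorff_measurable_closed compact_imp_closed)
  then have "one_rectifiable (\<gamma> ` A)"
    unfolding one_rectifiable_def using A(2)
    by (intro conjI exI[of _ "\<lambda>_. A"] exI[of _ "\<lambda>_. \<gamma>"]) auto
  then have "hausdorff dist 1 (S \<inter> \<gamma> ` A) = 0" using S by (simp add: purely_one_unrectifiable_def)
  moreover have "S \<inter> \<gamma> ` A = \<gamma> ` A" using A K by blast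
  ultimately show "hausdorff dist 1 (\<gamma> ` A) = 0" by simp
qed

lemma curve_null_of_less:
  fixes K :: "'a::metric_space set"
  assumes "0 < s" "s < 1" "hausdorff dist s K < \<infinity>"
  shows "curve_null K"
  unfolding curve_null_def
  using hausdorff_one_null_of_less[OF assms] hausdorff_mono[of _ K dist 1] by fastforce

section \<open>Residuality\<close>

text \<open>Every ball contains a flattened function, and a ball around that function lies in the set of functions for
which \<open>K\<close> has an image of small content.\<close>

lemma dense_small_content:
  fixes K :: "'a::metric_space set" and p :: ereal and L :: real
  defines "M \<equiv> (Lip (lp_metric p) L :: ('a \<Rightarrow> real ^ 'm) metric)"
  assumes s: "0 < s" and p: "1 \<le> p" and L: "0 \<le> L" and K: "compact K" "hausdorff dist s K < \<infinity>" "curve_null K"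
    and \<nu>: "0 < \<nu>"
  shows "mtopology_of M closure_of
    (mtopology_of M interior_of {f \<in> mspace M. hausdorff_pre (mdist (lp_metric p)) s \<nu> (f ` K) \<le> ennreal \<nu>}) = mspace M"
proof -
  interpret Lip: Metric_space "mspace M" "mdist M" by simp
  have top: "mtopology_of M = Lip.mtopology" by (simp add: mtopology_of_def)
  define Q where "Q = {f \<in> mspace M. hausdorff_pre (mdist (lp_metric p)) s \<nu> (f ` K) \<le> ennreal \<nu>}"
  note mspace = mspace_Lip_lp_metric[OF p, of L, where ?'a = 'a and ?'b = 'm, folded M_def]
  note mdist = mdist_Lip_lp_metric[OF p, of _ L, where ?'a = 'a and ?'b = 'm, folded M_def]
  have dle: "mdist M f g \<le> e" if "f \<in> mspace M" "g \<in> mspace M" "\<And>x. lp_norm p (f x - g x) \<le> e" for f g e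
    unfolding mdist[OF that(1,2)] using that(3) by (intro cSUP_least) auto
  have lpd: "lp_norm p (f x - g x) \<le> mdist M f g" if fg: "f \<in> mspace M" "g \<in> mspace M" for f g x
  proof -
    obtain B B' where "\<And>x. lp_norm p (f x) \<le> B" "\<And>x. lp_norm p (g x) \<le> B'" using fg mspace by blast
    then have "lp_norm p (f x - g x) \<le> B + B'" for x
      using lp_norm_triangle[OF p, of "f x" "- g x"] lp_norm_minus_commute[of p "g x" 0]
      by (smt (verit) diff_0 diff_0_right add_uminus_conv_diff)
    then show ?thesis unfolding mdist[OF fg] by (intro cSUP_upper bdd_aboveI2) auto
  qed
  have "\<exists>g\<in>Lip.mtopology interior_of Q. mdist M f g < e" if f: "f \<in> mspace M" and e: "0 < e" for f e
  proof -
    obtain B where fB: "\<And>x. lp_norm p (f x) \<le> B" and fL: "\<And>x y. lp_norm p (f x - f y) \<le> L * dist x y"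
      using f mspace by blast
    define m where "m = enn2real (hausdorff dist s K) + 1"
    have m: "0 < m" by (simp add: m_def add_nonneg_pos)
    define \<theta> where "\<theta> = (\<nu> / (2 * m)) powr (1 / s)"
    have \<theta>: "0 < \<theta>" "\<theta> powr s * m < \<nu>"
      using m \<nu> s by (auto simp: \<theta>_def powr_powr field_simps)
    have "0 < e / 2" using e by simp
    from vector_flattening[OF K(1,3) p fL fB L \<theta>(1) this]
    obtain \<delta> g where "0 < \<delta>" "\<forall>x y. lp_norm p (g x - g y) \<le> L * dist x y" "\<forall>x. lp_norm p (f x - g x) \<le> e / 2"
      "\<forall>x\<in>K. \<forall>y\<in>K. dist x y \<le> \<delta> \<longrightarrow> lp_norm p (g x - g y) \<le> \<theta> * dist x y"
      by (elim exE conjE)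
    then have g: "0 < \<delta>" "\<And>x y. lp_norm p (g x - g y) \<le> L * dist x y" "\<And>x. lp_norm p (f x - g x) \<le> e / 2"
      "\<And>x y. x \<in> K \<Longrightarrow> y \<in> K \<Longrightarrow> dist x y \<le> \<delta> \<Longrightarrow> lp_norm p (g x - g y) \<le> \<theta> * dist x y"
      by blast+
    have "lp_norm p (g x) \<le> B + e / 2" for x
      using lp_norm_triangle[OF p, of "f x" "g x - f x"] lp_norm_minus_commute[of p "f x" "g x"] fB[of x] g(3)[of x]
      by simp
    then have gM: "g \<in> mspace M" using g(2) mspace by blast
    obtain \<rho> where \<rho>: "0 < \<rho>" "\<And>f' :: 'a \<Rightarrow> real ^ 'm. (\<And>x y. x \<in> K \<Longrightarrow> y \<in> K \<Longrightarrow>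
        lp_norm p (f' x - f' y) \<le> lp_norm p (g x - g y) + \<rho>)
      \<Longrightarrow> hausdorff_pre (mdist (lp_metric p)) s \<nu> (f' ` K) \<le> ennreal \<nu>"
      using hausdorff_pre_image_near_flat[OF s K(1,2) g(1), of "mdist (lp_metric p)" g \<theta> \<nu>] g(4) \<theta> \<nu> p
      by (auto simp: m_def)
    have "Lip.mball g (\<rho> / 2) \<subseteq> Q"
    proof
      fix f' assume "f' \<in> Lip.mball g (\<rho> / 2)"
      then have f': "f' \<in> mspace M" "mdist M g f' < \<rho> / 2" by auto
      have "lp_norm p (f' x - f' y) \<le> lp_norm p (g x - g y) + \<rho>" for x y
      proof -
        have "f' x - f' y = (f' x - g x) + ((g x - g y) + (g y - f' y))" by simp
        then have "lp_norm p (f' x - f' y) \<le> lp_norm p (f' x - g x) + (lp_norm p (g x - g y) + lp_norm p (g y - f' y))"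
          using lp_norm_triangle[OF p] by (smt (verit))
        then show ?thesis
          using lpd[OF gM f'(1), of x] lpd[OF gM f'(1), of y] f'(2) lp_norm_minus_commute[of p "f' x" "g x"] by linarith
      qed
      then show "f' \<in> Q" using \<rho>(2) f'(1) by (simp add: Q_def)
    qed
    then have "g \<in> Lip.mtopology interior_of Q"
      using \<rho>(1) gM by (auto simp: interior_of_def intro!: exI[of _ "Lip.mball g (\<rho> / 2)"])
    moreover have "mdist M f g \<le> e / 2" by (rule dle[OF f gM g(3)])
    ultimately show ?thesis using e by (intro bexI[of _ g]) auto
  qed
  moreover have "Lip.mtopology interior_of Q \<subseteq> mspace M"
    using interior_of_subset_topspace[of Lip.mtopology Q] by simp
  ultimately have "Lip.mtopology closure_of (Lip.mtopology interior_of Q) = mspace M"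
    unfolding Lip.metric_closure_of by (auto simp: in_mono)
  then show ?thesis by (simp add: top Q_def)
qed

theorem theorem6p4:
  fixes S :: "'a::complete_space set" and s L :: real and p :: ereal
  assumes "s > 0"
    and "hausdorff_measurable s S"
    and "sigma_finite_hausdorff s S"
    and "(s \<in> \<nat> \<and> purely_one_unrectifiable S) \<or> s < 1"
    and "1 \<le> p"
    and "L \<ge> 0"
  shows "residual_in
    (mtopology_of (Lip (lp_metric p) L :: ('a \<Rightarrow> real ^ 'm) metric))
    {f \<in> mspace (Lip (lp_metric p) L). hausdorff (mdist (lp_metric p)) s (f ` S) = 0}"
proof -
  let ?M = "Lip (lp_metric p) L :: ('a \<Rightarrow> real ^ 'm) metric"
  let ?H = "hausdorff dist s :: 'a set \<Rightarrow> ennreal" and ?d = "mdist (lp_metric p) :: real ^ 'm \<Rightarrow> _"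
  note s = assms(1) and p = assms(5) and L = assms(6)
  obtain T :: "nat \<Rightarrow> 'a set" where "\<forall>i. hausdorff_measurable s (T i) \<and> ?H (T i) < \<infinity>" "S = (\<Union>i. T i)"
    using assms(3) unfolding sigma_finite_hausdorff_def by (elim exE conjE)
  then have T: "\<And>i. hausdorff_measurable s (T i)" "\<And>i. ?H (T i) < \<infinity>" "S = (\<Union>i. T i)"
    by blast+
  have "\<exists>C. compact C \<and> C \<subseteq> T i \<and> ?H (T i - C) \<le> ennreal (1 / real (Suc k))" for i k
  proof -
    have "0 < 1 / real (Suc k)" by simp
    from hausdorff_inner_compact[OF s T(1,2) this, of i] show ?thesis by metis
  qed
  then obtain C where C: "\<And>i k. compact (C i k)" "\<And>i k. C i k \<subseteq> T i"
    "\<And>i k. ?H (T i - C i k) \<le> ennreal (1 / real (Suc k))" by metis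
  have Cfin: "?H (C i k) < \<infinity>" for i k
    using hausdorff_mono[OF C(2), of dist s i k] T(2)[of i] by (rule le_less_trans)
  have Cnull: "curve_null (C i k)" for i k
    using assms(4)
  proof
    assume "s \<in> \<nat> \<and> purely_one_unrectifiable S"
    then show ?thesis using C(2) T(3) by (intro curve_null_of_unrectifiable[of S]) blast+
  next
    assume "s < 1"
    then show ?thesis using Cfin by (intro curve_null_of_less[OF s])
  qed
  \<comment> \<open>The null remainder that no compact piece meets; Lipschitz maps send it to a null set.\<close>
  define N where "N = (\<Union>i. T i - (\<Union>k. C i k))"
  have "?H (T i - (\<Union>k. C i k)) = 0" for i
  proof -
    have "?H (T i - (\<Union>k. C i k)) \<le> 0"
    proof (rule ennreal_le_epsilon)
      fix e :: real assume "0 < e"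
      then obtain k where k: "1 / real (Suc k) < e" using nat_approx_posE by blast
      have "?H (T i - (\<Union>k. C i k)) \<le> ?H (T i - C i k)" by (rule hausdorff_mono) auto
      also note C(3)
      also have "ennreal (1 / real (Suc k)) \<le> 0 + ennreal e" using k by (simp add: ennreal_leI)
      finally show "?H (T i - (\<Union>k. C i k)) \<le> 0 + ennreal e" .
    qed
    then show ?thesis by simp
  qed
  then have N: "?H N = 0" unfolding N_def by (intro hausdorff_UN_null)
  have SN: "S \<subseteq> N \<union> (\<Union>i. \<Union>k. C i k)" unfolding N_def T(3) by blast
  define \<nu> where "\<nu> j = 1 / real (Suc j)" for j
  define Q where "Q i k j = {f \<in> mspace ?M. hausdorff_pre ?d s (\<nu> j) (f ` C i k) \<le> ennreal (\<nu> j)}" for i k j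
  define W where "W n = (case prod_decode n of (i, n') \<Rightarrow> case prod_decode n' of (k, j) \<Rightarrow> mtopology_of ?M interior_of Q i k j)" for n
  show ?thesis
    unfolding residual_in_def
  proof (intro conjI exI[of _ W] allI)
    show "{f \<in> mspace ?M. hausdorff ?d s (f ` S) = 0} \<subseteq> topspace (mtopology_of ?M)" by auto
    show "openin (mtopology_of ?M) (W n)" for n by (simp add: W_def split: prod.split)
    show "mtopology_of ?M closure_of (W n) = topspace (mtopology_of ?M)" for n
      unfolding W_def Q_def
      using dense_small_content[OF s p L C(1) Cfin Cnull, where 'm = 'm] by (auto simp: \<nu>_def split: prod.split)
    show "(\<Inter>n. W n) \<subseteq> {f \<in> mspace ?M. hausdorff ?d s (f ` S) = 0}"
    proof
      fix f assume "f \<in> (\<Inter>n. W n)"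
      then have "f \<in> W (prod_encode (i, prod_encode (k, j)))" for i k j by blast
      then have "f \<in> mtopology_of ?M interior_of Q i k j" for i k j by (simp add: W_def)
      then have f: "f \<in> Q i k j" for i k j using interior_of_subset by (rule subsetD[rotated])
      then have fM: "f \<in> mspace ?M" by (simp add: Q_def)
      have "hausdorff ?d s (f ` C i k) \<le> 0" for i k
        unfolding hausdorff_eq_SUP
      proof (rule SUP_least)
        fix \<delta> :: real assume "\<delta> \<in> {0<..}"
        then have \<delta>: "0 < \<delta>" by simp
        show "hausdorff_pre ?d s \<delta> (f ` C i k) \<le> 0"
        proof (rule ennreal_le_epsilon)
          fix e :: real assume "0 < e"
          with \<delta> obtain j where "1 / real (Suc j) < min \<delta> e" using nat_approx_posE[of "min \<delta> e"] by auto
          then have j: "\<nu> j \<le> \<delta>" "\<nu> j \<le> e" by (auto simp: \<nu>_def)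
          have "hausdorff_pre ?d s \<delta> (f ` C i k) \<le> hausdorff_pre ?d s (\<nu> j) (f ` C i k)"
            by (rule hausdorff_pre_antimono[OF j(1)])
          also have "\<dots> \<le> ennreal (\<nu> j)" using f[of i k j] by (simp add: Q_def)
          also have "\<dots> \<le> 0 + ennreal e" using j(2) by (simp add: ennreal_leI)
          finally show "hausdorff_pre ?d s \<delta> (f ` C i k) \<le> 0 + ennreal e" .
        qed
      qed
      then have "hausdorff ?d s (f ` C i k) = 0" for i k by simp
      then have "hausdorff ?d s (\<Union>i. \<Union>k. f ` C i k) = 0" by (intro hausdorff_UN_null)
      moreover have "hausdorff ?d s (f ` N) = 0"
      proof (rule hausdorff_lipschitz_image_null[OF s N _ L])
        show "?d (f x) (f y) \<le> L * dist x y" for x y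
          using fM p unfolding mspace_Lip_lp_metric[OF p] by simp
      qed
      ultimately have "hausdorff ?d s (f ` N \<union> (\<Union>i. \<Union>k. f ` C i k)) \<le> 0"
        using hausdorff_Un_le[of ?d s "f ` N" "\<Union>i. \<Union>k. f ` C i k"] by simp
      moreover have "f ` S \<subseteq> f ` N \<union> (\<Union>i. \<Union>k. f ` C i k)"
        using image_mono[OF SN, of f] by (simp only: image_Un image_UN)
      then have "hausdorff ?d s (f ` S) \<le> hausdorff ?d s (f ` N \<union> (\<Union>i. \<Union>k. f ` C i k))"
        by (rule hausdorff_mono)
      ultimately have "hausdorff ?d s (f ` S) \<le> 0" by (rule order_trans[rotated])
      then show "f \<in> {f \<in> mspace ?M. hausdorff ?d s (f ` S) = 0}" using fM by simp
    qed
  qed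
qed

end
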